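(* Let $k\ge -1$ be an integer and let $P$ be a polygon with exactly $n$ corners, where $n\ge k+4$. Then \[g_k(P)\le \frac{n}{k+4}.\] Moreover, for every integer $t\ge 1$, there exists a polygon $P_{k,t}$ such that \[g_k(P_{k,t}) = t = \frac{|V(P_{k,t})|}{k+4}.\]
   Context: A polygon $P$ here is a simple polygon in the plane, regarded as the closed region it bounds (including its sides and corners). $V(P)$ denotes the set of corners of $P$; a polygon with $n$ sides has $n$ corners, cyclically ordered along its perimeter. Two points of $P$ are visible to each other if the straight line segment joining them does not intersect the exterior of $P$. Guards are placed at points of $P$. $g_k(P)$ denotes the minimum number of guards that can be placed in $P$ so that among every $k+2$ consecutive corners on the perimeter of $P$, at least one is visible to at least one guard (for $k=-1$, every corner must be visible to at least one guard). *)

theory Defs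
  imports "HOL-Analysis.Analysis"
begin

text \<open>
  The Euclidean plane is \<^typ>\<open>complex\<close>, the type for which the library states the Jordan curve
  theorem. A polygon is given by the list of its corners in cyclic order along the perimeter
  (either orientation, any starting corner); indices are read modulo the length of the list.
\<close>

definition corner :: "complex list \<Rightarrow> nat \<Rightarrow> complex" where
  "corner P i = P ! (i mod length P)"

definition side :: "complex list \<Rightarrow> nat \<Rightarrow> complex set" where
  "side P i = closed_segment (corner P i) (corner P (Suc i))"

text \<open>
  The intersection condition says that two sides meet only in a common corner, hence
  non-adjacent sides are disjoint. The last condition excludes straight angles, so that the
  listed points are exactly the geometric corners of the region.
\<close>

definition simple_polygon :: "complex list \<Rightarrow> bool" where
  "simple_polygon P \<longleftrightarrow>
     3 \<le> length P \<and> distinct P \<and>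
     (\<forall>i < length P. \<forall>j < length P. i \<noteq> j \<longrightarrow>
        side P i \<inter> side P j =
          {corner P i, corner P (Suc i)} \<inter> {corner P j, corner P (Suc j)}) \<and>
     (\<forall>i < length P. \<not> collinear {corner P i, corner P (Suc i), corner P (Suc (Suc i))})"

definition corners :: "complex list \<Rightarrow> complex set" where
  "corners P = set P"

definition perimeter :: "complex list \<Rightarrow> complex set" where
  "perimeter P = (\<Union>i < length P. side P i)"

definition region :: "complex list \<Rightarrow> complex set" where
  "region P = perimeter P \<union> inside (perimeter P)"

definition exterior :: "complex list \<Rightarrow> complex set" where
  "exterior P = outside (perimeter P)"

definition visible :: "complex list \<Rightarrow> complex \<Rightarrow> complex \<Rightarrow> bool" where
  "visible P x y \<longleftrightarrow>
     x \<in> region P \<and> y \<in> region P \<and> closed_segment x y \<inter> exterior P = {}"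

definition guards :: "int \<Rightarrow> complex list \<Rightarrow> complex set \<Rightarrow> bool" where
  "guards k P G \<longleftrightarrow>
     finite G \<and> G \<subseteq> region P \<and>
     (\<forall>i < length P. \<exists>j::nat. int j < k + 2 \<and> (\<exists>g \<in> G. visible P g (corner P (i + j))))"

definition guard_number :: "int \<Rightarrow> complex list \<Rightarrow> nat" where
  "guard_number k P = (LEAST m. \<exists>G. guards k P G \<and> card G = m)"

text \<open>The minimum is attained: a guard at every corner always suffices.\<close>

lemma guards_corners:
  assumes "k \<ge> -1"
  shows "guards k P (corners P)"
proof -
  have perim: "corner P i \<in> perimeter P" if "i < length P" for i
    using that by (auto simp: perimeter_def side_def)
  have sub: "corners P \<subseteq> perimeter P"
  proof
    fix x assume "x \<in> corners P"
    then obtain i where "i < length P" "x = P ! i"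
      by (auto simp: corners_def in_set_conv_nth)
    then show "x \<in> perimeter P"
      using perim[of i] by (simp add: corner_def)
  qed
  have self: "visible P x x" if "x \<in> perimeter P" for x
    using that by (auto simp: visible_def region_def exterior_def outside_def)
  show ?thesis
    unfolding guards_def
  proof (intro conjI allI impI)
    show "finite (corners P)" by (simp add: corners_def)
    show "corners P \<subseteq> region P" using sub by (auto simp: region_def)
    fix i assume i: "i < length P"
    then have "corner P (i + 0) \<in> corners P" by (simp add: corners_def corner_def)
    then show "\<exists>j::nat. int j < k + 2 \<and> (\<exists>g \<in> corners P. visible P g (corner P (i + j)))"
      using assms self sub by (intro exI[of _ 0]) auto
  qed
qed

lemma guard_number_attained:
  assumes "k \<ge> -1"
  shows "\<exists>G. guards k P G \<and> card G = guard_number k P"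
  unfolding guard_number_def
  by (rule LeastI_ex) (use guards_corners[OF assms, of P] in blast)

end

theory Submission
  imports Defs
begin

text \<open>
  Write \<open>s = k + 4\<close>. A guard at a corner sees this corner and both its neighbours, so guards at
  every \<open>s\<close>-th corner leave only runs of \<open>s - 3 = k + 1\<close> consecutive corners unseen, which is
  fewer than \<open>k + 2\<close>. This uses \<open>n / s\<close> guards rounded up. To round down instead, one guard has
  to profit from seeing across the polygon.

  The gain comes from a single triangle. Suppose that three corners \<open>x, c, y\<close> see each other
  pairwise, that at most \<open>s - 1\<close> sides lie between \<open>x\<close> and \<open>c\<close> and between \<open>c\<close> and \<open>y\<close>,
  and that \<open>e \<ge> s\<close> sides lie between \<open>x\<close> and \<open>y\<close> on the side of \<open>c\<close>. If \<open>e > s\<close>, a guard at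
  \<open>c\<close> takes care of everything between \<open>x\<close> and \<open>y\<close>, and the remaining \<open>n - e - 1 \<le> n - s - 2\<close>
  corners, a run whose two neighbours \<open>x\<close> and \<open>y\<close> are seen already, need only \<open>n div s - 1\<close>
  further guards. If \<open>e = s\<close>, a guard at \<open>x\<close> or at \<open>y\<close> does the same and in addition sees the next corner
  outside, which makes up for the missing one. This is \<open>suffices_triangle\<close>.

  Such a triangle is found by descent (\<open>weak_polygon_balanced_triangle\<close>). In a polygon with more
  than \<open>s\<close> corners, a fixed side has an apex: a corner that is joined to both ends of this side by
  sides or diagonals (\<open>weak_polygon_apex\<close>). If one of the two other sides of this triangle still
  cuts off \<open>s\<close> or more sides, the part that it cuts off is a smaller polygon with more than \<open>s\<close>
  corners; otherwise the triangle is the desired one. An apex exists because polygons can be cut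
  along diagonals. That every polygon with at least four corners has a diagonal is proved as usual
  from an extreme corner (\<open>weak_polygon_diagonal\<close>); the Jordan curve theorem supplies interior and
  exterior. Since a diagonal may prolong a side, all of this is done for polygons that may have
  straight angles.

  The bound is attained by a comb with \<open>t\<close> teeth. Each tooth has \<open>k + 2\<close> corners at its top and
  two at its bottom, and it is so tall compared with its opening that a guard who sees a top corner
  must stand less than half a unit outside the tooth (\<open>visible_slope\<close>); neighbouring teeth have
  distance one, so no guard serves two of them.
\<close>

section \<open>Polygonal lines and polygons with straight angles\<close>

text \<open>
  The inductive step of \<open>simple_polyline_append\<close> below, reduced to sets: a new first segment \<open>E\<close>
  meets the old line \<open>P\<close>, the joining segment \<open>e\<close> and the appended line \<open>Y\<close>. It can meet \<open>e\<close> only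
  in a point of \<open>P\<close>, because \<open>e\<close> has only its own end in common with \<open>E \<union> P\<close>.
\<close>

lemma prepend_segment_iff:
  fixes P Y E e :: "'a set"
  assumes "b \<in> P" "l \<in> P" "l \<in> e" "h \<in> e" "h \<in> Y" "b \<in> E"
  shows "(a \<noteq> b \<and> E \<inter> (P \<union> e \<union> Y) = {b} \<and> S \<and> R \<and> l \<noteq> h \<and> e \<inter> P = {l} \<and> e \<inter> Y = {h} \<and> P \<inter> Y = {})
   \<longleftrightarrow> ((a \<noteq> b \<and> E \<inter> P = {b} \<and> S) \<and> R \<and> l \<noteq> h \<and> e \<inter> (E \<union> P) = {l} \<and> e \<inter> Y = {h} \<and> (E \<union> P) \<inter> Y = {})"
    (is "?L \<longleftrightarrow> ?R")
proof
  assume L: ?L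
  then have "e \<inter> (E \<union> P) = {l}" using assms by auto
  moreover have "(E \<union> P) \<inter> Y = {}" "E \<inter> P = {b}" using L assms by auto
  ultimately show ?R using L by simp
next
  assume R: ?R
  then have eq: "E \<inter> P = {b}" "e \<inter> (E \<union> P) = {l}" "(E \<union> P) \<inter> Y = {}" by simp_all
  have "E \<inter> e \<subseteq> {l}" unfolding eq(2)[symmetric] by blast
  then have "E \<inter> e \<subseteq> E \<inter> P" using assms(2) by auto
  moreover have "E \<inter> Y = {}" using eq(3) by (simp add: Int_Un_distrib2)
  ultimately have "E \<inter> (P \<union> e \<union> Y) = {b}" unfolding Int_Un_distrib eq(1) by auto
  moreover have "e \<inter> P \<subseteq> {l}" unfolding eq(2)[symmetric] by blast
  then have "e \<inter> P = {l}" using assms(2,3) by auto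
  moreover have "P \<inter> Y = {}" using eq(3) by (simp add: Int_Un_distrib2)
  ultimately show ?L using R by simp
qed

text \<open>
  Two lines \<open>X\<close> and \<open>Y\<close> are joined into a closed curve by two segments \<open>e\<close> and \<open>f\<close>. The left-hand
  side adds \<open>e\<close> first and closes up with \<open>f\<close>; the right-hand side treats both alike, which makes
  the rotation of polygons evident.
\<close>

lemma close_up_iff:
  assumes "hx \<in> X" "lx \<in> X" "hy \<in> Y" "ly \<in> Y" "lx \<in> e" "hy \<in> e" "ly \<in> f" "hx \<in> f"
  shows "((S \<and> T \<and> lx \<noteq> hy \<and> e \<inter> X = {lx} \<and> e \<inter> Y = {hy} \<and> X \<inter> Y = {}) \<and>
     f \<inter> (X \<union> e \<union> Y) = {ly, hx}) \<longleftrightarrow>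
    (S \<and> T \<and> X \<inter> Y = {} \<and> e \<inter> X = {lx} \<and> e \<inter> Y = {hy} \<and> f \<inter> X = {hx} \<and> f \<inter> Y = {ly} \<and>
      e \<inter> f \<subseteq> {lx, hy} \<inter> {ly, hx})" (is "?L \<longleftrightarrow> ?R")
proof
  assume L: ?L
  then have *: "X \<inter> Y = {}" "e \<inter> X = {lx}" "e \<inter> Y = {hy}" "f \<inter> (X \<union> e \<union> Y) = {ly, hx}" by simp_all
  then have "f \<inter> X = {hx}" using assms by auto
  moreover from * have "f \<inter> Y = {ly}" using assms by auto
  moreover have "e \<inter> f \<subseteq> {ly, hx}" using * by auto
  moreover have "e \<inter> f \<subseteq> X \<union> Y" using calculation(3) assms by auto
  then have "e \<inter> f \<subseteq> {lx, hy}" using *(2,3) by auto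
  ultimately show ?R using L by simp
next
  assume R: ?R
  then have "lx \<noteq> hy" using assms by auto
  moreover have "f \<inter> (X \<union> e \<union> Y) = {ly, hx}"
  proof -
    have "f \<inter> (X \<union> e \<union> Y) = f \<inter> X \<union> f \<inter> Y \<union> e \<inter> f" by auto
    then show ?thesis using R by auto
  qed
  ultimately show ?L using R by simp
qed

fun polyline :: "complex list \<Rightarrow> complex set" where
  "polyline [] = {}"
| "polyline [a] = {a}"
| "polyline (a # b # xs) = closed_segment a b \<union> polyline (b # xs)"

fun simple_polyline :: "complex list \<Rightarrow> bool" where
  "simple_polyline [] = True"
| "simple_polyline [a] = True"
| "simple_polyline (a # b # xs) \<longleftrightarrow>
     a \<noteq> b \<and> closed_segment a b \<inter> polyline (b # xs) = {b} \<and> simple_polyline (b # xs)"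

definition boundary :: "complex list \<Rightarrow> complex set" where
  "boundary xs = polyline xs \<union> closed_segment (last xs) (hd xs)"

text \<open>
  Only the meeting of sides is restricted here, not their angles: a piece that a diagonal cuts off
  from a simple polygon can have a straight angle at an end of the diagonal. The side from the last
  corner back to the first one is singled out as the base of the polygon.
\<close>

definition weak_polygon :: "complex list \<Rightarrow> bool" where
  "weak_polygon xs \<longleftrightarrow> 3 \<le> length xs \<and> simple_polyline xs \<and>
     closed_segment (last xs) (hd xs) \<inter> polyline xs = {last xs, hd xs}"

lemma set_subset_polyline: "set xs \<subseteq> polyline xs"
  by (induction xs rule: polyline.induct) auto

lemma hd_in_polyline: "xs \<noteq> [] \<Longrightarrow> hd xs \<in> polyline xs"
  using set_subset_polyline by fastforce

lemma last_in_polyline: "xs \<noteq> [] \<Longrightarrow> last xs \<in> polyline xs"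
  using set_subset_polyline by fastforce

lemma compact_polyline: "compact (polyline xs)"
  by (induction xs rule: polyline.induct) auto

lemma polyline_append:
  assumes "xs \<noteq> []" "ys \<noteq> []"
  shows "polyline (xs @ ys) = polyline xs \<union> closed_segment (last xs) (hd ys) \<union> polyline ys"
  using assms
proof (induction xs rule: polyline.induct)
  case (2 a)
  then show ?case by (cases ys) auto
qed auto

lemma simple_polyline_append:
  assumes "xs \<noteq> []" "ys \<noteq> []"
  shows "simple_polyline (xs @ ys) \<longleftrightarrow>
    simple_polyline xs \<and> simple_polyline ys \<and> last xs \<noteq> hd ys \<and>
    closed_segment (last xs) (hd ys) \<inter> polyline xs = {last xs} \<and>
    closed_segment (last xs) (hd ys) \<inter> polyline ys = {hd ys} \<and>
    polyline xs \<inter> polyline ys = {}"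
  using assms
proof (induction xs rule: polyline.induct)
  case (2 a)
  then show ?case
    using hd_in_polyline[of ys] by (cases ys) auto
next
  case (3 a b xs)
  let ?e = "closed_segment (last (b # xs)) (hd ys)"
  have l: "last (b # xs) \<in> polyline (b # xs)" by (rule last_in_polyline) simp
  have h: "hd ys \<in> polyline ys" using 3 by (simp add: hd_in_polyline)
  have b: "b \<in> polyline (b # xs)" using set_subset_polyline[of "b # xs"] by auto
  have pl: "polyline (b # xs @ ys) = polyline (b # xs) \<union> ?e \<union> polyline ys"
    using polyline_append[of "b # xs" ys] 3 by simp
  have IH: "simple_polyline (b # xs @ ys) \<longleftrightarrow>
    simple_polyline (b # xs) \<and> simple_polyline ys \<and> last (b # xs) \<noteq> hd ys \<and>
    ?e \<inter> polyline (b # xs) = {last (b # xs)} \<and>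
    ?e \<inter> polyline ys = {hd ys} \<and> polyline (b # xs) \<inter> polyline ys = {}"
    using 3 by simp
  have ends: "last (b # xs) \<in> ?e" "hd ys \<in> ?e" by simp_all
  show ?case
    unfolding append_Cons simple_polyline.simps polyline.simps(3) pl IH
      last_ConsR[OF list.distinct(2), of a b xs]
    using prepend_segment_iff[OF b l ends h] by simp
qed auto

lemma simple_polyline_distinct: "simple_polyline xs \<Longrightarrow> distinct xs"
proof (induction xs rule: polyline.induct)
  case (3 a b xs)
  then show ?case
    using set_subset_polyline[of "b # xs"] ends_in_segment[of a b] by auto
qed auto

lemma boundary_append:
  assumes "xs \<noteq> []" "ys \<noteq> []"
  shows "boundary (xs @ ys) = polyline xs \<union> polyline ys \<union>
    closed_segment (last xs) (hd ys) \<union> closed_segment (last ys) (hd xs)"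
  using assms by (auto simp: boundary_def polyline_append)

lemma boundary_rotate: "boundary (ys @ xs) = boundary (xs @ ys)"
  by (cases "xs = [] \<or> ys = []") (auto simp: boundary_append)

lemma weak_polygon_append:
  assumes "xs \<noteq> []" "ys \<noteq> []" "3 \<le> length (xs @ ys)"
  shows "weak_polygon (xs @ ys) \<longleftrightarrow>
    simple_polyline xs \<and> simple_polyline ys \<and> polyline xs \<inter> polyline ys = {} \<and>
    closed_segment (last xs) (hd ys) \<inter> polyline xs = {last xs} \<and>
    closed_segment (last xs) (hd ys) \<inter> polyline ys = {hd ys} \<and>
    closed_segment (last ys) (hd xs) \<inter> polyline xs = {hd xs} \<and>
    closed_segment (last ys) (hd xs) \<inter> polyline ys = {last ys} \<and>
    closed_segment (last xs) (hd ys) \<inter> closed_segment (last ys) (hd xs)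
      \<subseteq> {last xs, hd ys} \<inter> {last ys, hd xs}"
proof -
  have m: "hd xs \<in> polyline xs" "last xs \<in> polyline xs" "hd ys \<in> polyline ys" "last ys \<in> polyline ys"
    using assms by (simp_all add: hd_in_polyline last_in_polyline)
  have e: "last xs \<in> closed_segment (last xs) (hd ys)" "hd ys \<in> closed_segment (last xs) (hd ys)"
     "last ys \<in> closed_segment (last ys) (hd xs)" "hd xs \<in> closed_segment (last ys) (hd xs)" by simp_all
  have eq: "weak_polygon (xs @ ys) \<longleftrightarrow> simple_polyline (xs @ ys) \<and>
     closed_segment (last ys) (hd xs) \<inter>
      (polyline xs \<union> closed_segment (last xs) (hd ys) \<union> polyline ys) = {last ys, hd xs}"
    using assms by (simp add: weak_polygon_def polyline_append)
  show ?thesis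
    unfolding eq simple_polyline_append[OF assms(1,2)]
    by (rule close_up_iff[OF m e])
qed

lemma weak_polygon_rotate:
  assumes "weak_polygon (xs @ ys)" shows "weak_polygon (ys @ xs)"
proof (cases "xs = [] \<or> ys = []")
  case False
  then show ?thesis
    using assms weak_polygon_append[of xs ys] weak_polygon_append[of ys xs]
    by (auto simp: weak_polygon_def[of "xs @ ys"])
qed (use assms in auto)

lemma simple_polyline_arc:
  assumes "simple_polyline xs" "2 \<le> length xs"
  shows "\<exists>g. arc g \<and> pathstart g = hd xs \<and> pathfinish g = last xs \<and> path_image g = polyline xs"
  using assms
proof (induction xs rule: polyline.induct)
  case (3 a b xs)
  show ?case
  proof (cases xs)
    case Nil
    then show ?thesis using 3 by (intro exI[of _ "linepath a b"]) auto
  next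
    case (Cons c ys)
    with 3 obtain g where g: "arc g" "pathstart g = b" "pathfinish g = last (b # xs)"
      "path_image g = polyline (b # xs)" by auto
    have "arc (linepath a b +++ g)"
      using 3 g by (intro arc_join) auto
    then show ?thesis
      using g by (intro exI[of _ "linepath a b +++ g"]) (auto simp: path_image_join)
  qed
qed auto

lemma weak_polygon_simple_path:
  assumes "weak_polygon xs"
  obtains g where "simple_path g" "pathfinish g = pathstart g" "path_image g = boundary xs"
proof -
  have xs: "3 \<le> length xs" "simple_polyline xs"
    "closed_segment (last xs) (hd xs) \<inter> polyline xs = {last xs, hd xs}"
    using assms by (auto simp: weak_polygon_def)
  obtain g where g: "arc g" "pathstart g = hd xs" "pathfinish g = last xs"
    "path_image g = polyline xs"
    using simple_polyline_arc[of xs] xs by auto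
  have ne: "last xs \<noteq> hd xs"
    using g(1-3) arc_distinct_ends by metis
  let ?h = "g +++ linepath (last xs) (hd xs)"
  have "simple_path ?h"
    using g xs ne by (intro simple_path_join_loop) auto
  moreover have "pathfinish ?h = pathstart ?h" "path_image ?h = boundary xs"
    using g by (auto simp: path_image_join boundary_def)
  ultimately show ?thesis using that by blast
qed

section \<open>Cutting a polygon along a diagonal\<close>

text \<open>
  The two halves \<open>P \<union> e\<close> and \<open>Q \<union> f\<close> of a closed polygonal curve that is cut at the corners \<open>p\<close>
  and \<open>q\<close>. The segments \<open>e\<close> and \<open>f\<close> could share a further end only if \<open>P\<close> and \<open>Q\<close> met.
\<close>

lemma half_boundaries_meet:
  fixes P Q e f :: "'a set"
  assumes "P \<inter> Q = {}" "f \<inter> P = {p}" "e \<inter> Q = {q}" "e \<inter> f \<subseteq> {a, q} \<inter> {b, p}"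
    and "a \<in> P" "b \<in> Q"
  shows "(P \<union> e) \<inter> (Q \<union> f) = {p, q}"
proof -
  have "a \<noteq> b" using assms by auto
  then have "e \<inter> f \<subseteq> {p, q}" using assms(4) by auto
  moreover have "(P \<union> e) \<inter> (Q \<union> f) = P \<inter> Q \<union> f \<inter> P \<union> e \<inter> Q \<union> e \<inter> f" by auto
  ultimately show ?thesis using assms(1-3) by auto
qed

text \<open>
  The corners \<open>p\<close> and \<open>q\<close> split the boundary into two arcs, and the diagonal forms a theta curve
  with them. The inside of a theta curve is divided by its middle arc, so each of the two smaller
  closed curves has its inside within the old one.
\<close>

lemma weak_polygon_cut_off:
  assumes W: "weak_polygon ((p # B) @ (q # D))"
    and diag: "open_segment p q \<subseteq> inside (boundary ((p # B) @ (q # D)))"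
  shows "weak_polygon (p # B @ [q])"
    and "inside (boundary (p # B @ [q])) \<subseteq> inside (boundary ((p # B) @ (q # D)))"
    and "length (p # B @ [q]) < length ((p # B) @ (q # D))"
proof -
  let ?X = "boundary ((p # B) @ (q # D))"
  let ?c1 = "polyline (p # B @ [q])" and ?c2 = "polyline (q # D @ [p])"
  let ?c = "closed_segment p q"
  have len: "3 \<le> length ((p # B) @ (q # D))" using W by (simp add: weak_polygon_def)
  note W' = W[unfolded weak_polygon_append[of "p # B" "q # D", OF list.distinct(2) list.distinct(2) len]]
  have c1: "?c1 = polyline (p # B) \<union> closed_segment (last (p # B)) q"
    using polyline_append[of "p # B" "[q]"] by (auto simp del: last.simps)
  have c2: "?c2 = polyline (q # D) \<union> closed_segment (last (q # D)) p"
    using polyline_append[of "q # D" "[p]"] by (auto simp del: last.simps)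
  have X: "?X = ?c1 \<union> ?c2"
    using boundary_append[of "p # B" "q # D"] c1 c2 by auto
  have pq: "p \<noteq> q" using W simple_polyline_distinct[of "(p # B) @ (q # D)"]
    by (auto simp: weak_polygon_def)
  have ends: "last (p # B) \<in> polyline (p # B)" "last (q # D) \<in> polyline (q # D)"
    by (rule last_in_polyline; simp)+
  have c12: "?c1 \<inter> ?c2 = {p, q}"
    unfolding c1 c2 by (rule half_boundaries_meet) (use W' ends in simp_all)
  have out: "open_segment p q \<inter> ?X = {}"
    using diag inside_no_overlap by blast
  have c: "?c \<inter> ?X = {p, q}"
    using out X c12 by (auto simp: closed_segment_eq_open)
  have ne: "open_segment p q \<noteq> {}" using pq by simp
  \<comment> \<open>A diagonal is not a side, as the open segment would then lie on the boundary.\<close>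
  have "B \<noteq> []"
  proof
    assume "B = []"
    then have "open_segment p q \<subseteq> ?X" unfolding X by (auto simp: open_segment_def)
    then show False using out ne by blast
  qed
  have "D \<noteq> []"
  proof
    assume "D = []"
    then have "open_segment p q \<subseteq> ?X" unfolding X
      by (auto simp: open_segment_def closed_segment_commute)
    then show False using out ne by blast
  qed
  then show "length (p # B @ [q]) < length ((p # B) @ (q # D))" by auto
  have s1: "simple_polyline (p # B @ [q])"
    using W' simple_polyline_append[of "p # B" "[q]"] pq by auto
  have s2: "simple_polyline (q # D @ [p])"
    using W' simple_polyline_append[of "q # D" "[p]"] pq by auto
  show W1: "weak_polygon (p # B @ [q])"
    using s1 c c12 \<open>B \<noteq> []\<close> X
    by (auto simp: weak_polygon_def closed_segment_commute neq_Nil_conv)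
  obtain g1 where g1: "arc g1" "pathstart g1 = p" "pathfinish g1 = q" "path_image g1 = ?c1"
    using simple_polyline_arc[OF s1] by auto
  obtain g2 where g2: "arc g2" "pathstart g2 = q" "pathfinish g2 = p" "path_image g2 = ?c2"
    using simple_polyline_arc[OF s2] by auto
  have "inside (path_image g1 \<union> path_image (linepath p q)) \<subseteq>
      inside (path_image g1 \<union> path_image (reversepath g2))"
  proof (rule split_inside_simple_closed_curve[of g1 p q "reversepath g2" "linepath p q"])
    show "path_image (linepath p q) \<inter>
        inside (path_image g1 \<union> path_image (reversepath g2)) \<noteq> {}"
      using ne diag g1 g2 X by (auto simp: open_segment_def)
    show "path_image g1 \<inter> path_image (linepath p q) = {p, q}"
      using c c12 X g1 by auto
    show "path_image (reversepath g2) \<inter> path_image (linepath p q) = {p, q}"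
      using c c12 X g2 by auto
  qed (use g1 g2 pq c12 in \<open>auto simp: arc_imp_simple_path simple_path_reversepath\<close>)
  then show "inside (boundary (p # B @ [q])) \<subseteq> inside ?X"
    using g1 g2 X by (simp add: boundary_def closed_segment_commute)
qed

text \<open>
  Cutting at \<open>p\<close> and at \<open>q\<close> is symmetric up to rotation, so both pieces are instances of the
  previous lemma. The second piece keeps the base of \<open>xs\<close>, as needed for inductions in which the
  base is fixed.
\<close>

lemma weak_polygon_split:
  assumes W: "weak_polygon xs" and xs: "xs = A @ p # B @ q # C"
    and diag: "open_segment p q \<subseteq> inside (boundary xs)"
  shows "weak_polygon (p # B @ [q])"
    and "inside (boundary (p # B @ [q])) \<subseteq> inside (boundary xs)"
    and "length (p # B @ [q]) < length xs"
    and "weak_polygon (A @ p # q # C)"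
    and "inside (boundary (A @ p # q # C)) \<subseteq> inside (boundary xs)"
    and "length (A @ p # q # C) < length xs"
proof -
  have W1: "weak_polygon ((p # B) @ (q # C @ A))"
    using weak_polygon_rotate[of A "p # B @ q # C"] W xs by simp
  have b1: "boundary ((p # B) @ (q # C @ A)) = boundary xs"
    using boundary_rotate[of A "p # B @ q # C"] xs by simp
  show "weak_polygon (p # B @ [q])" "inside (boundary (p # B @ [q])) \<subseteq> inside (boundary xs)"
     "length (p # B @ [q]) < length xs"
    using weak_polygon_cut_off[OF W1, unfolded b1, OF diag] unfolding xs by auto
  have W2: "weak_polygon ((q # C @ A) @ (p # B))"
    using weak_polygon_rotate[OF W1] by simp
  have b2: "boundary ((q # C @ A) @ (p # B)) = boundary xs"
    using boundary_rotate[of "q # C @ A" "p # B"] b1 by simp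
  note h = weak_polygon_cut_off[OF W2, unfolded b2 open_segment_commute[of q p], OF diag]
  show "weak_polygon (A @ p # q # C)"
    using weak_polygon_rotate[of "q # C" "A @ [p]"] h(1) by simp
  show "inside (boundary (A @ p # q # C)) \<subseteq> inside (boundary xs)"
    using boundary_rotate[of "q # C" "A @ [p]"] h(2) by simp
  show "length (A @ p # q # C) < length xs" using h(3) xs by simp
qed

section \<open>The interior angle at an extreme corner\<close>

lemma connected_subset_inside:
  fixes S :: "'a::real_normed_vector set"
  assumes "connected C" "closed S" "C \<inter> S = {}" "C \<inter> inside S \<noteq> {}"
  shows "C \<subseteq> inside S"
proof -
  have "C \<inter> outside S = {}"
    using connectedD[OF assms(1) open_inside[OF assms(2)] open_outside[OF assms(2)]] assms(3,4)
      inside_Un_outside[of S] by auto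
  then show ?thesis using assms(3) inside_Un_outside[of S] by blast
qed

lemma connected_subset_outside:
  fixes S :: "'a::real_normed_vector set"
  assumes "connected C" "closed S" "C \<inter> S = {}" "C \<inter> outside S \<noteq> {}"
  shows "C \<subseteq> outside S"
proof -
  have "C \<inter> inside S = {}"
    using connectedD[OF assms(1) open_inside[OF assms(2)] open_outside[OF assms(2)]] assms(3,4)
      inside_Un_outside[of S] by auto
  then show ?thesis using assms(3) inside_Un_outside[of S] by blast
qed

text \<open>
  Affine coordinates with origin \<open>v\<close> in the basis \<open>u - v\<close>, \<open>w - v\<close>. They turn the geometry near a
  corner \<open>v\<close> with neighbours \<open>u\<close> and \<open>w\<close> into sign conditions on \<open>a\<close> and \<open>b\<close>: the cone spanned by
  the angle is where both are nonnegative, and the side \<open>u w\<close> of the triangle is where their sum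
  is \<open>1\<close>.
\<close>

locale affine_frame =
  fixes v u w :: complex and a b :: "complex \<Rightarrow> real"
  assumes a_affine: "a ((1 - t) *\<^sub>R x + t *\<^sub>R y) = (1 - t) * a x + t * a y"
    and b_affine: "b ((1 - t) *\<^sub>R x + t *\<^sub>R y) = (1 - t) * b x + t * b y"
    and a_v: "a v = 0" and a_u: "a u = 1" and a_w: "a w = 0"
    and b_v: "b v = 0" and b_u: "b u = 0" and b_w: "b w = 1"
    and expand: "v + a z *\<^sub>R (u - v) + b z *\<^sub>R (w - v) = z"

lemma affine_frame_exists:
  assumes "\<not> collinear {v, u, w}"
  obtains a b where "affine_frame v u w a b"
proof -
  define p q where "p = u - v" and "q = w - v"
  define D where "D = Re p * Im q - Im p * Re q"
  have D: "D \<noteq> 0"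
  proof
    assume "D = 0"
    have "collinear {0, p, q}"
    proof (cases "p = 0")
      case False
      have "q = (Re (q * cnj p) / (norm p)^2) *\<^sub>R p"
      proof -
        have "Im (q * cnj p) = 0" using \<open>D = 0\<close> by (simp add: D_def algebra_simps)
        then have "q * cnj p = of_real (Re (q * cnj p))" by (simp add: complex_eq_iff)
        then have "q * cnj p * p = of_real (Re (q * cnj p)) * p" by simp
        moreover have "cnj p * p = of_real ((norm p)^2)"
          by (metis complex_norm_square mult.commute)
        ultimately have "q * of_real ((norm p)^2) = of_real (Re (q * cnj p)) * p"
          by (simp add: mult.assoc)
        then show ?thesis
          using False by (simp add: scaleR_conv_of_real field_simps)
      qed
      then show ?thesis using collinear_lemma[of p q] by blast
    qed auto
    then have "collinear {v, u, w}"
      using collinear_3[of u v w] unfolding p_def q_def by (simp add: insert_commute)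
    then show False using assms by simp
  qed
  \<comment> \<open>Cramer's rule for \<open>z - v = a p + b q\<close>.\<close>
  define a where "a z = (Re (z - v) * Im q - Im (z - v) * Re q) / D" for z
  define b where "b z = (Re p * Im (z - v) - Im p * Re (z - v)) / D" for z
  have "affine_frame v u w a b"
  proof
    fix t x y z
    show "a ((1 - t) *\<^sub>R x + t *\<^sub>R y) = (1 - t) * a x + t * a y"
      using D by (simp add: a_def field_simps)
    show "b ((1 - t) *\<^sub>R x + t *\<^sub>R y) = (1 - t) * b x + t * b y"
      using D by (simp add: b_def field_simps)
    show "a v = 0" "b v = 0" by (simp_all add: a_def b_def)
    show "a u = 1" "a w = 0" "b u = 0" "b w = 1"
      using D by (simp_all add: a_def b_def D_def p_def q_def)
    have "D *\<^sub>R z = D *\<^sub>R v + (D * a z) *\<^sub>R p + (D * b z) *\<^sub>R q"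
      using D by (simp add: a_def b_def complex_eq_iff) (simp add: D_def algebra_simps)
    also have "\<dots> = D *\<^sub>R (v + a z *\<^sub>R p + b z *\<^sub>R q)" by (simp add: scaleR_add_right)
    finally show "v + a z *\<^sub>R (u - v) + b z *\<^sub>R (w - v) = z"
      using D unfolding p_def q_def by simp
  qed
  then show ?thesis using that by blast
qed

context affine_frame
begin

lemma convex_coord_sets:
  "convex {z. a z < c}" "convex {z. b z < c}" "convex {z. 0 < a z}" "convex {z. 0 < b z}"
  "convex {z. a z + b z < c}" "convex {z. a z + b z \<le> c}"
proof -
  have lt: "(1 - t) * r + t * s < c" if "r < c" "s < c" "0 \<le> t" "t \<le> 1" for r s t c :: real
    using that convex_bound_lt[of r c s "1 - t" t] by simp
  have le: "(1 - t) * r + t * s \<le> c" if "r \<le> c" "s \<le> c" "0 \<le> t" "t \<le> 1" for r s t c :: real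
    using that convex_bound_le[of r c s "1 - t" t] by simp
  have gt: "0 < (1 - t) * r + t * s" if "0 < r" "0 < s" "0 \<le> t" "t \<le> 1" for r s t :: real
    using lt[of "-r" 0 "-s" t] that by simp
  have s: "a ((1 - t) *\<^sub>R x + t *\<^sub>R y) + b ((1 - t) *\<^sub>R x + t *\<^sub>R y)
     = (1 - t) * (a x + b x) + t * (a y + b y)" for t x y
    unfolding a_affine b_affine by (simp add: algebra_simps)
  show "convex {z. a z < c}" "convex {z. b z < c}" "convex {z. 0 < a z}" "convex {z. 0 < b z}"
    unfolding convex_alt mem_Collect_eq a_affine b_affine
    by (auto intro!: lt gt)
  show "convex {z. a z + b z < c}" "convex {z. a z + b z \<le> c}"
    unfolding convex_alt mem_Collect_eq s
    by (auto intro!: lt le)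
qed

lemma on_segment_vw: "a z = 0 \<Longrightarrow> 0 \<le> b z \<Longrightarrow> b z \<le> 1 \<Longrightarrow> z \<in> closed_segment v w"
  using expand[of z] unfolding in_segment
  by (intro exI[of _ "b z"]) (simp add: complex_eq_iff algebra_simps)

lemma on_segment_vu: "b z = 0 \<Longrightarrow> 0 \<le> a z \<Longrightarrow> a z \<le> 1 \<Longrightarrow> z \<in> closed_segment v u"
  using expand[of z] unfolding in_segment
  by (intro exI[of _ "a z"]) (simp add: complex_eq_iff algebra_simps)

lemma coords_eqI: "a x = a y \<Longrightarrow> b x = b y \<Longrightarrow> x = y"
  using expand[of x] expand[of y] by metis

lemma segment_vu_coords: "z \<in> closed_segment v u \<Longrightarrow> b z = 0 \<and> 0 \<le> a z"
  unfolding in_segment by (auto simp: a_affine b_affine a_v a_u b_v b_u)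

lemma segment_vw_coords: "z \<in> closed_segment v w \<Longrightarrow> a z = 0 \<and> 0 \<le> b z"
  unfolding in_segment by (auto simp: a_affine b_affine a_v a_w b_v b_w)

text \<open>
  The point with both coordinates \<open>r\<close>. It lies on the median of the triangle through \<open>v\<close>: inside the
  angle for positive \<open>r\<close> and inside the opposite angle for negative \<open>r\<close>.
\<close>

definition median_point :: "real \<Rightarrow> complex" where
  "median_point r = v + r *\<^sub>R (u - v) + r *\<^sub>R (w - v)"

lemma median_point_coords: "a (median_point r) = r" "b (median_point r) = r"
proof -
  let ?m = "(1/2) *\<^sub>R u + (1/2) *\<^sub>R w"
  have m: "a ?m = 1/2" "b ?m = 1/2"
    using a_affine[of "1/2" u w] b_affine[of "1/2" u w] by (simp_all add: a_u a_w b_u b_w)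
  have "median_point r = (1 - 2 * r) *\<^sub>R v + (2 * r) *\<^sub>R ?m"
    by (simp add: median_point_def complex_eq_iff algebra_simps)
  then show "a (median_point r) = r" "b (median_point r) = r"
    using a_affine[of "2 * r" v ?m] b_affine[of "2 * r" v ?m] m a_v b_v by simp_all
qed

lemma dist_median_point: "dist v (median_point r) \<le> \<bar>r\<bar> * (norm (u - v) + norm (w - v))"
proof -
  have "median_point r - v = r *\<^sub>R (u - v) + r *\<^sub>R (w - v)"
    by (simp add: median_point_def)
  then have "dist v (median_point r) = norm (r *\<^sub>R (u - v) + r *\<^sub>R (w - v))"
    by (metis dist_commute dist_norm)
  also have "\<dots> \<le> \<bar>r\<bar> * (norm (u - v) + norm (w - v))"
    by (rule norm_triangle_le) (simp add: distrib_left)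
  finally show ?thesis .
qed

lemma median_point_near:
  assumes "e > 0"
  obtains d where "d > 0" "\<And>r. \<bar>r\<bar> \<le> d \<Longrightarrow> median_point r \<in> ball v e"
proof
  define N where "N = norm (u - v) + norm (w - v)"
  have N: "0 \<le> N" by (simp add: N_def)
  show "e / (N + 1) > 0" using N assms by simp
  fix r assume "\<bar>r\<bar> \<le> e / (N + 1)"
  then have "\<bar>r\<bar> * N \<le> e / (N + 1) * N" using N by (intro mult_right_mono)
  also have "\<dots> < e" using N assms by (simp add: field_simps)
  finally show "median_point r \<in> ball v e"
    using dist_median_point[of r] by (simp add: N_def)
qed

text \<open>
  Close to \<open>v\<close> the curve consists of two segments only, which separate a small disc into the open
  sector and the rest \<open>?R\<close> of the disc. Both are connected and avoid the curve. The rest contains a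
  point beyond \<open>v\<close> that is not in the convex hull because \<open>v\<close> is extreme, so it lies outside. As \<open>v\<close>
  is on the frontier of the inside, the sector has to contain inside points, and thus lies inside.
\<close>

lemma sector_inside:
  assumes T: "compact T" "v \<notin> T"
    and S: "S = closed_segment v u \<union> closed_segment w v \<union> T"
    and g: "simple_path g" "pathfinish g = pathstart g" "path_image g = S"
    and ext: "v extreme_point_of (convex hull S)"
  obtains e where "e > 0" "ball v e \<inter> {z. 0 < a z \<and> 0 < b z} \<subseteq> inside S"
proof -
  have cS: "closed S" using g by (metis closed_simple_path_image)
  have ne: "u \<noteq> v" "w \<noteq> v" using a_u a_v b_w b_v by auto
  obtain e0 where e0: "e0 > 0" "ball v e0 \<inter> T = {}"
    using T separate_point_closed[of T v] compact_imp_closed[of T]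
    by (metis disjoint_iff linorder_not_le mem_ball)
  define e where "e = min e0 (min (norm (u - v)) (norm (w - v)))"
  have e: "e > 0" "ball v e \<inter> T = {}" "e \<le> norm (u - v)" "e \<le> norm (w - v)"
    using e0 ne by (auto simp: e_def)
  let ?B = "ball v e"
  let ?R = "(?B \<inter> {z. a z < 0}) \<union> (?B \<inter> {z. b z < 0})"
  have near: "z \<in> S" if "z \<in> ?B" "0 \<le> a z" "0 \<le> b z" "a z = 0 \<or> b z = 0" for z
  proof -
    from that(4) show ?thesis
    proof
      assume 0: "a z = 0"
      then have "dist v z = b z * norm (w - v)"
        using expand[of z] that(3) by (metis abs_of_nonneg add_diff_cancel_left' add.right_neutral dist_commute dist_norm norm_scaleR scaleR_zero_left)
      then have "b z * norm (w - v) < 1 * norm (w - v)" using that(1) e(4) by simp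
      then have "b z \<le> 1" by (metis less_eq_real_def mult_less_cancel_right norm_ge_zero not_less)
      then show ?thesis using on_segment_vw[of z] 0 that(3) S by (auto simp: closed_segment_commute)
    next
      assume 0: "b z = 0"
      then have "dist v z = a z * norm (u - v)"
        using expand[of z] that(2) by (metis abs_of_nonneg add_diff_cancel_left' add.right_neutral dist_commute dist_norm norm_scaleR scaleR_zero_left)
      then have "a z * norm (u - v) < 1 * norm (u - v)" using that(1) e(3) by simp
      then have "a z \<le> 1" by (metis less_eq_real_def mult_less_cancel_right norm_ge_zero not_less)
      then show ?thesis using on_segment_vu[of z] 0 that(2) S by auto
    qed
  qed
  have off: "z \<notin> S" if "z \<in> ?B" "a z < 0 \<or> b z < 0 \<or> (0 < a z \<and> 0 < b z)" for z
    using that e(2) segment_vu_coords[of z] segment_vw_coords[of z]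
    unfolding S closed_segment_commute[of w v] by force
  obtain d where d: "d > 0" "\<And>r. \<bar>r\<bar> \<le> d \<Longrightarrow> median_point r \<in> ?B"
    using median_point_near[OF e(1)] by blast
  define r where "r = min d (1/2)"
  have r: "0 < r" "r \<le> 1/2" "median_point r \<in> ?B" "median_point (-r) \<in> ?B"
    using d by (auto simp: r_def)
  \<comment> \<open>The angle at v being less than straight, \<open>?R\<close> is a union of two overlapping half discs.\<close>
  have R_conn: "connected ?R"
  proof (rule connected_Un)
    show "connected (?B \<inter> {z. a z < 0})" "connected (?B \<inter> {z. b z < 0})"
      by (intro convex_connected convex_Int convex_ball convex_coord_sets)+
    show "(?B \<inter> {z. a z < 0}) \<inter> (?B \<inter> {z. b z < 0}) \<noteq> {}"
      using r median_point_coords[of "-r"] by auto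
  qed
  have in_hull: "median_point r \<in> convex hull S"
  proof -
    have "v \<in> S" "u \<in> S" "w \<in> S" using S by auto
    then have "convex hull {v, u, w} \<subseteq> convex hull S" by (intro hull_mono) auto
    moreover have "median_point r \<in> convex hull {v, u, w}"
      unfolding convex_hull_3 mem_Collect_eq
      using r by (intro exI[of _ "1 - 2 * r"] exI[of _ r]) (simp add: median_point_def complex_eq_iff algebra_simps)
    ultimately show ?thesis by blast
  qed
  have "median_point (-r) \<notin> convex hull S"
  proof
    assume h: "median_point (-r) \<in> convex hull S"
    have "v = (1 - 1/2) *\<^sub>R median_point (-r) + (1/2) *\<^sub>R median_point r"
      by (simp add: median_point_def complex_eq_iff algebra_simps)
    moreover have "median_point (-r) \<noteq> median_point r"
      using median_point_coords[of r] median_point_coords[of "-r"] r(1) by auto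
    ultimately have "v \<in> open_segment (median_point (-r)) (median_point r)"
      unfolding in_segment by (intro conjI exI[of _ "1/2"]) auto
    then show False using ext h in_hull by (auto simp: extreme_point_of_def)
  qed
  then have "median_point (-r) \<in> outside S"
    using outside_subset_convex[of "convex hull S" S] hull_subset[of S convex] by auto
  then have R_out: "?R \<subseteq> outside S"
    using r median_point_coords[of "-r"] off
    by (intro connected_subset_outside[OF R_conn cS]) auto
  have "v \<in> frontier (inside S)"
    using Jordan_inside_outside[OF g(1,2)] g(3) S by auto
  then obtain y where y: "y \<in> inside S" "y \<in> ?B"
    using e(1) by (auto simp: frontier_def closure_approachable dist_commute)
  have "y \<notin> S" "y \<notin> ?R" using y(1) R_out inside_Int_outside[of S] inside_no_overlap[of S] by blast+
  then have "0 < a y \<and> 0 < b y" using near[OF y(2)] y(2) by force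
  then have "?B \<inter> {z. 0 < a z \<and> 0 < b z} \<subseteq> inside S"
    using y off
    by (intro connected_subset_inside[OF _ cS] convex_connected)
       (auto intro!: convex_Int convex_coord_sets simp: Collect_conj_eq)
  then show ?thesis using e(1) that by blast
qed

end

section \<open>Existence of diagonals\<close>

lemma polyline_edge:
  assumes "x \<in> polyline zs" "2 \<le> length zs"
  obtains L p q R where "zs = L @ p # q # R" "x \<in> closed_segment p q"
proof -
  have "\<exists>L p q R. zs = L @ p # q # R \<and> x \<in> closed_segment p q"
    using assms
  proof (induction zs rule: polyline.induct)
    case (3 p q xs)
    show ?case
    proof (cases "x \<in> closed_segment p q")
      case True
      then show ?thesis by (intro exI[of _ "[]"] exI[of _ p] exI[of _ q] exI[of _ xs]) simp
    next
      case False
      then have x: "x \<in> polyline (q # xs)" using 3 by auto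
      have "xs \<noteq> []" using x False by auto
      then obtain L p' q' R where "q # xs = L @ p' # q' # R" "x \<in> closed_segment p' q'"
        using 3(1)[OF x] by (cases xs) auto
      then show ?thesis
        by (intro exI[of _ "p # L"] exI[of _ p'] exI[of _ q'] exI[of _ R]) simp
    qed
  qed auto
  then show ?thesis using that by blast
qed

lemma edge_subset_polyline: "closed_segment p q \<subseteq> polyline (L @ p # q # R)"
  by (cases "L = []") (auto simp: polyline_append)

text \<open>
  Used to exclude a side that runs along the segment from \<open>u\<close> to \<open>w\<close>: it would be the only one.
\<close>

lemma simple_polyline_edge_through_ends:
  assumes "simple_polyline (L @ p # q # R)"
    and "hd (L @ p # q # R) \<in> closed_segment p q" "last (L @ p # q # R) \<in> closed_segment p q"
  shows "L = [] \<and> R = []"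
proof (intro conjI; rule ccontr)
  assume L: "L \<noteq> []"
  then have "polyline L \<inter> polyline (p # q # R) = {}"
    using assms(1) by (simp add: simple_polyline_append del: polyline.simps)
  then show False
    using assms(2) L hd_in_polyline[OF L] edge_subset_polyline[of p q "[]" R] by auto
next
  assume R: "R \<noteq> []"
  have "simple_polyline ((L @ [p, q]) @ R)" using assms(1) by simp
  then have "polyline (L @ [p, q]) \<inter> polyline R = {}"
    using R simple_polyline_append[of "L @ [p, q]" R] by blast
  then show False
    using assms(3) R last_in_polyline[OF R] edge_subset_polyline[of p q L "[]"] by auto
qed

text \<open>
  The list starts with an extreme corner \<open>v\<close>, so that its neighbours are the second and the last
  entry. The other sides form the line \<open>T\<close>, which meets the two sides at \<open>v\<close> only in \<open>u\<close> and \<open>w\<close>.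
\<close>

locale extreme_corner = affine_frame +
  fixes ys :: "complex list"
  assumes weak: "weak_polygon (v # u # ys @ [w])" and ys: "ys \<noteq> []"
    and extreme: "v extreme_point_of (convex hull (boundary (v # u # ys @ [w])))"
begin

abbreviation T :: "complex set" where "T \<equiv> polyline (u # ys @ [w])"
abbreviation S :: "complex set" where "S \<equiv> boundary (v # u # ys @ [w])"

lemma S_eq: "S = closed_segment v u \<union> closed_segment w v \<union> T"
  by (auto simp: boundary_def)

lemma simple_T: "simple_polyline (u # ys @ [w])" "distinct (v # u # ys @ [w])"
  using weak simple_polyline_distinct[of "v # u # ys @ [w]"] by (auto simp: weak_polygon_def)

lemma vu_T: "closed_segment v u \<inter> T = {u}"
  using weak by (auto simp: weak_polygon_def)

lemma v_notin_T: "v \<notin> T"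
  using vu_T simple_T(2) by auto

lemma vw_T: "closed_segment v w \<inter> T = {w}"
proof -
  have "closed_segment w v \<inter> (closed_segment v u \<union> T) = {w, v}"
    using weak by (simp add: weak_polygon_def)
  moreover have "w \<in> T" using set_subset_polyline[of "u # ys @ [w]"] by auto
  ultimately show ?thesis using v_notin_T unfolding closed_segment_commute[of v w] by auto
qed

text \<open>
  To leave the angle at \<open>v\<close>, the segment would have to cross one of the two sides at \<open>v\<close> in a point
  with \<open>a + b < 1\<close>. But \<open>T\<close> meets these sides only in \<open>u\<close> and \<open>w\<close>, where \<open>a + b = 1\<close>.
\<close>

lemma descending_edge_stays:
  assumes "0 < a x" "0 < b x" "a x + b x \<le> 1" "a y + b y < 1" "closed_segment x y \<subseteq> T"
  shows "0 \<le> a y \<and> 0 \<le> b y"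
proof (rule ccontr)
  assume "\<not> ?thesis"
  then have neg: "min (a y) (b y) < 0" by auto
  \<comment> \<open>The smaller coordinate along the segment; its zero is the crossing point.\<close>
  define h where "h t = min ((1 - t) * a x + t * a y) ((1 - t) * b x + t * b y)" for t :: real
  have "\<exists>t. 0 \<le> t \<and> t \<le> 1 \<and> h t = 0"
  proof (rule IVT2')
    show "h 1 \<le> 0" "0 \<le> h 0" using neg assms by (auto simp: h_def)
    show "continuous_on {0..1} h" unfolding h_def by (intro continuous_intros)
  qed auto
  then obtain t where t: "0 \<le> t" "t \<le> 1" "h t = 0" by blast
  have "t \<noteq> 0" using t(3) assms by (auto simp: h_def)
  define z where "z = (1 - t) *\<^sub>R x + t *\<^sub>R y"
  have z: "z \<in> T"
    using assms(5) t unfolding z_def by (meson in_segment(1) subsetD)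
  have az: "a z = (1 - t) * a x + t * a y" "b z = (1 - t) * b x + t * b y"
    by (simp_all add: z_def a_affine b_affine)
  have "a z + b z = (1 - t) * (a x + b x) + t * (a y + b y)" by (simp add: az algebra_simps)
  also have "\<dots> \<le> (1 - t) * 1 + t * (a y + b y)" using t assms by (intro add_mono mult_left_mono) auto
  also have "\<dots> < (1 - t) * 1 + t * 1" using t \<open>t \<noteq> 0\<close> assms by simp
  finally have s: "a z + b z < 1" by simp
  have "min (a z) (b z) = 0" using t(3) by (simp add: h_def az)
  then have "a z = 0 \<and> 0 \<le> b z \<or> b z = 0 \<and> 0 \<le> a z" by (auto simp: min_def split: if_splits)
  then have "z = u \<or> z = w"
    using on_segment_vw[of z] on_segment_vu[of z] s z vu_T vw_T by auto
  then show False using s by (auto simp: a_u b_u a_w b_w)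
qed

text \<open>
  If the corners in the angle all have \<open>a + b \<ge> \<tau>\<close>, then no side enters the cap of the triangle below
  this level: one end of the side would lie at least as low as the point in the cap, and
  also in the angle by the previous lemma.
\<close>

lemma cap_free:
  assumes "\<tau> \<le> 1"
    and min: "\<And>y. y \<in> set (u # ys @ [w]) \<Longrightarrow> 0 \<le> a y \<Longrightarrow> 0 \<le> b y \<Longrightarrow> \<tau> \<le> a y + b y"
    and "0 < a x" "0 < b x" "a x + b x < \<tau>"
  shows "x \<notin> T"
proof
  assume "x \<in> T"
  then obtain L p q R where e: "u # ys @ [w] = L @ p # q # R" "x \<in> closed_segment p q"
    by (rule polyline_edge) auto
  have pq: "p \<in> set (u # ys @ [w])" "q \<in> set (u # ys @ [w])" unfolding e(1) by auto
  have E: "closed_segment p q \<subseteq> T" unfolding e(1) by (rule edge_subset_polyline)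
  obtain t where t: "0 \<le> t" "t \<le> 1" "x = (1 - t) *\<^sub>R p + t *\<^sub>R q"
    using e(2) by (auto simp: in_segment)
  have eq: "a x + b x = (1 - t) * (a p + b p) + t * (a q + b q)"
    unfolding t(3) a_affine b_affine by (simp add: algebra_simps)
  have "\<not> (\<tau> \<le> a p + b p \<and> \<tau> \<le> a q + b q)"
  proof
    assume "\<tau> \<le> a p + b p \<and> \<tau> \<le> a q + b q"
    then have "(1 - t) * \<tau> + t * \<tau> \<le> a x + b x"
      unfolding eq using t(1,2) by (intro add_mono mult_left_mono) auto
    then show False using assms(5) by (simp add: algebra_simps)
  qed
  then obtain y where y: "y = p \<or> y = q" "a y + b y < \<tau>" by force
  have "closed_segment x y \<subseteq> T"
    using E e(2) y(1) by (meson closed_segment_subset convex_closed_segment ends_in_segment subset_trans)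
  then have "0 \<le> a y \<and> 0 \<le> b y"
    using assms y by (intro descending_edge_stays[of x]) auto
  then show False using min[of y] y pq by auto
qed

text \<open>
  If the triangle contains no further corner, then not even the segment from \<open>u\<close> to \<open>w\<close> is met by
  another side. A side through one of its points cannot reach below this level, so it runs along the
  line \<open>u w\<close>; having no corner strictly between \<open>u\<close> and \<open>w\<close>, it contains both of them.
\<close>

lemma far_side_free:
  assumes none: "\<And>y. y \<in> set ys \<Longrightarrow> \<not> (0 \<le> a y \<and> 0 \<le> b y \<and> a y + b y \<le> 1)"
    and x: "0 < a x" "0 < b x" "a x + b x = 1"
  shows "x \<notin> T"
proof
  assume "x \<in> T"
  then obtain L p q R where e: "u # ys @ [w] = L @ p # q # R" "x \<in> closed_segment p q"
    by (rule polyline_edge) auto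
  have E: "closed_segment p q \<subseteq> T" unfolding e(1) by (rule edge_subset_polyline)
  have corner: "1 < a y + b y \<or> (a y + b y = 1 \<and> (a y \<le> 0 \<or> b y \<le> 0))" if "y = p \<or> y = q" for y
  proof -
    have y: "y \<in> set (u # ys @ [w])" using that unfolding e(1) by auto
    have "closed_segment x y \<subseteq> T"
      using E e(2) that by (meson closed_segment_subset convex_closed_segment ends_in_segment subset_trans)
    then have "a y + b y < 1 \<Longrightarrow> 0 \<le> a y \<and> 0 \<le> b y"
      using x by (intro descending_edge_stays[of x]) auto
    then show ?thesis using y none[of y] by (auto simp: a_u b_u a_w b_w) force+
  qed
  obtain t where t: "0 \<le> t" "t \<le> 1" "x = (1 - t) *\<^sub>R p + t *\<^sub>R q"
    using e(2) by (auto simp: in_segment)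
  have ax: "a x = (1 - t) * a p + t * a q" and bx: "b x = (1 - t) * b p + t * b q"
    unfolding t(3) a_affine b_affine by simp_all
  have "t \<noteq> 0" "t \<noteq> 1" using t corner[of p] corner[of q] x by auto
  then have t': "0 < t" "t < 1" using t by auto
  have 1: "(1 - t) * (a p + b p - 1) + t * (a q + b q - 1) = 0"
    using x(3) unfolding ax bx by (simp add: algebra_simps)
  have ge: "0 \<le> a p + b p - 1" "0 \<le> a q + b q - 1" using corner[of p] corner[of q] by auto
  have "(1 - t) * (a p + b p - 1) = 0 \<and> t * (a q + b q - 1) = 0"
    using 1 ge t' by (subst (asm) add_nonneg_eq_0_iff) auto
  then have eq1: "a p + b p = 1" "a q + b q = 1" using t' by auto
  have bp: "b p = 1 - a p" "b q = 1 - a q" using eq1 by auto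
  have opp: "(a p \<le> 0 \<and> 1 \<le> a q) \<or> (1 \<le> a p \<and> a q \<le> 0)"
  proof -
    have "a p \<le> 0 \<or> 1 \<le> a p" "a q \<le> 0 \<or> 1 \<le> a q"
      using corner[of p] corner[of q] eq1 by auto
    moreover have "\<not> (a p \<le> 0 \<and> a q \<le> 0)"
      using x(1) t' unfolding ax by (smt (verit) mult_nonneg_nonpos)
    moreover have "\<not> (1 \<le> a p \<and> 1 \<le> a q)"
    proof
      assume "1 \<le> a p \<and> 1 \<le> a q"
      then have "b p \<le> 0" "b q \<le> 0" using bp by auto
      then show False using x(2) t' unfolding bx by (smt (verit) mult_nonneg_nonpos)
    qed
    ultimately show ?thesis by auto
  qed
  have on_edge: "z \<in> closed_segment p q" if z: "a z + b z = 1" "0 \<le> a z" "a z \<le> 1" for z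
  proof -
    define r where "r = (a z - a p) / (a q - a p)"
    have ne: "a q - a p \<noteq> 0" using opp by auto
    have r: "0 \<le> r" "r \<le> 1"
      using opp z by (auto simp: r_def divide_simps)
    have "r * (a q - a p) = a z - a p" using ne by (simp add: r_def)
    then have az: "(1 - r) * a p + r * a q = a z" by (simp add: algebra_simps)
    then have "(1 - r) * b p + r * b q = b z" using z(1) unfolding bp by (simp add: algebra_simps)
    then have "z = (1 - r) *\<^sub>R p + r *\<^sub>R q"
      using az by (intro coords_eqI) (simp_all add: a_affine b_affine)
    then show ?thesis using r by (auto simp: in_segment)
  qed
  have "u \<in> closed_segment p q" "w \<in> closed_segment p q"
    by (intro on_edge; simp add: a_u b_u a_w b_w)+
  moreover have "hd (L @ p # q # R) = u" "last (L @ p # q # R) = w"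
    unfolding e(1)[symmetric] by simp_all
  moreover have "simple_polyline (L @ p # q # R)" using simple_T(1) unfolding e(1) .
  ultimately have "L = [] \<and> R = []"
    using simple_polyline_edge_through_ends[of L p q R] by metis
  then show False using e(1) ys by auto
qed

text \<open>
  Such a set avoids the whole curve, and it meets the sector at \<open>v\<close>, which lies inside.
\<close>

lemma convex_set_inside:
  assumes C: "convex C" "C \<subseteq> {z. 0 < a z \<and> 0 < b z}" "C \<inter> T = {}"
    and d: "0 < d" "\<And>r. 0 < r \<Longrightarrow> r < d \<Longrightarrow> median_point r \<in> C"
  shows "C \<subseteq> inside S"
proof -
  obtain g where g: "simple_path g" "pathfinish g = pathstart g" "path_image g = S"
    using weak_polygon_simple_path[OF weak] .
  obtain e where e: "e > 0" "ball v e \<inter> {z. 0 < a z \<and> 0 < b z} \<subseteq> inside S"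
    using sector_inside[OF compact_polyline v_notin_T S_eq g extreme] .
  obtain d' where d': "d' > 0" "\<And>r. \<bar>r\<bar> \<le> d' \<Longrightarrow> median_point r \<in> ball v e"
    using median_point_near[OF e(1)] by blast
  define r where "r = min d' (d / 2)"
  have "0 < r" "r < d" "\<bar>r\<bar> \<le> d'" using d(1) d'(1) by (auto simp: r_def)
  then have "median_point r \<in> C \<inter> inside S"
    using d(2) d'(2) e(2) median_point_coords[of r] by auto
  moreover have "z \<notin> S" if "z \<in> C" for z
  proof -
    have "0 < a z" "0 < b z" "z \<notin> T" using that C(2,3) by auto
    then show ?thesis
      using segment_vu_coords[of z] segment_vw_coords[of z]
      unfolding S_eq closed_segment_commute[of w v] by auto
  qed
  then have "C \<inter> S = {}" by blast
  moreover have "closed S" using g by (metis closed_simple_path_image)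
  ultimately show ?thesis
    using C(1) by (intro connected_subset_inside convex_connected) auto
qed

text \<open>
  If the triangle \<open>v u w\<close> contains no further corner, \<open>u w\<close> is a diagonal. Otherwise the
  segment from \<open>v\<close> to a corner \<open>z\<close> in the triangle with least \<open>a + b\<close> is one, since the cap below
  \<open>z\<close> is free.
\<close>

lemma diagonal_exists:
  "\<exists>p\<in>set (v # u # ys @ [w]). \<exists>q\<in>set (v # u # ys @ [w]). p \<noteq> q \<and> open_segment p q \<subseteq> inside S"
proof -
  define Z where "Z = {y \<in> set ys. 0 \<le> a y \<and> 0 \<le> b y \<and> a y + b y \<le> 1}"
  have pos: "convex {z. 0 < a z \<and> 0 < b z}"
    using convex_Int[OF convex_coord_sets(3,4)] by (simp add: Collect_conj_eq)
  show ?thesis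
  proof (cases "Z = {}")
    case True
    then have none: "\<not> (0 \<le> a y \<and> 0 \<le> b y \<and> a y + b y \<le> 1)" if "y \<in> set ys" for y
      using that by (auto simp: Z_def)
    let ?C = "{z. 0 < a z \<and> 0 < b z} \<inter> {z. a z + b z \<le> 1}"
    have "?C \<inter> T = {}"
    proof -
      have "x \<notin> T" if x: "0 < a x" "0 < b x" "a x + b x \<le> 1" for x
      proof (cases "a x + b x = 1")
        case True
        then show ?thesis using far_side_free[OF none] x by auto
      next
        case False
        have "1 \<le> a y + b y" if "y \<in> set (u # ys @ [w])" "0 \<le> a y" "0 \<le> b y" for y
          using that none[of y] by (auto simp: a_u b_u a_w b_w)
        then show ?thesis using x False by (intro cap_free[of 1]) auto
      qed
      then show ?thesis by auto
    qed
    then have "?C \<subseteq> inside S"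
      by (intro convex_set_inside[of _ "1/2"] convex_Int pos convex_coord_sets)
         (auto simp: median_point_coords)
    moreover have "open_segment u w \<subseteq> ?C"
      by (auto simp: in_segment a_affine b_affine a_u b_u a_w b_w)
    ultimately have "open_segment u w \<subseteq> inside S" by blast
    then show ?thesis using simple_T(2) by (intro bexI[of _ u] bexI[of _ w]) auto
  next
    case False
    have "finite Z" by (simp add: Z_def)
    then have "Min ((\<lambda>y. a y + b y) ` Z) \<in> (\<lambda>y. a y + b y) ` Z"
      using False by (intro Min_in) auto
    then obtain z where z: "z \<in> Z" "a z + b z = Min ((\<lambda>y. a y + b y) ` Z)" by auto
    have z_min: "a z + b z \<le> a y + b y" if "y \<in> Z" for y
      unfolding z(2) using \<open>finite Z\<close> that by (intro Min_le) auto
    let ?\<tau> = "a z + b z"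
    have zy: "z \<in> set ys" "0 \<le> a z" "0 \<le> b z" "?\<tau> \<le> 1" using z(1) by (auto simp: Z_def)
    have zT: "z \<in> T" using zy(1) set_subset_polyline[of "u # ys @ [w]"] by auto
    have "a z \<noteq> 0"
    proof
      assume "a z = 0"
      then have "z \<in> closed_segment v w \<inter> T" using zy on_segment_vw zT by auto
      then have "z = w" unfolding vw_T by simp
      then show False using zy(1) simple_T(2) by auto
    qed
    moreover have "b z \<noteq> 0"
    proof
      assume "b z = 0"
      then have "z \<in> closed_segment v u \<inter> T" using zy on_segment_vu zT by auto
      then have "z = u" unfolding vu_T by simp
      then show False using zy(1) simple_T(2) by auto
    qed
    ultimately have zpos: "0 < a z" "0 < b z" using zy by auto
    let ?C = "{z. 0 < a z \<and> 0 < b z} \<inter> {x. a x + b x < ?\<tau>}"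
    have min: "?\<tau> \<le> a y + b y" if "y \<in> set (u # ys @ [w])" "0 \<le> a y" "0 \<le> b y" for y
      using that z_min[of y] zy(4) by (cases "y \<in> Z") (auto simp: Z_def a_u b_u a_w b_w)
    have "?C \<inter> T = {}" using cap_free[OF zy(4) min] by auto
    then have "?C \<subseteq> inside S"
      using zpos by (intro convex_set_inside[of _ "?\<tau> / 2"] convex_Int pos convex_coord_sets)
         (auto simp: median_point_coords)
    moreover have "open_segment v z \<subseteq> ?C"
      using zpos by (auto simp: in_segment a_affine b_affine a_v b_v simp flip: distrib_left)
    ultimately have "open_segment v z \<subseteq> inside S" by blast
    then show ?thesis using simple_T(2) zy(1) by (intro bexI[of _ v] bexI[of _ z]) auto
  qed
qed

end

text \<open>
  The polygon is rotated so that it starts with an extreme point of its convex hull. The angle there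
  is not straight, because an extreme point is not between two other corners, and not zero, because
  the two sides have only the corner in common.
\<close>

lemma weak_polygon_diagonal:
  assumes W: "weak_polygon xs" and len: "4 \<le> length xs"
  obtains p q where "p \<in> set xs" "q \<in> set xs" "p \<noteq> q" "open_segment p q \<subseteq> inside (boundary xs)"
proof -
  have bd: "boundary xs \<subseteq> convex hull (set xs)"
  proof -
    have "polyline zs \<subseteq> convex hull (set zs)" for zs
    proof (induction zs rule: polyline.induct)
      case (3 p q zs)
      have "closed_segment p q \<subseteq> convex hull (set (p # q # zs))"
        by (simp add: segment_convex_hull hull_mono)
      moreover have "convex hull (set (q # zs)) \<subseteq> convex hull (set (p # q # zs))"
        by (intro hull_mono) auto
      ultimately show ?case using 3 by auto
    qed auto
    moreover have "closed_segment (last xs) (hd xs) \<subseteq> convex hull (set xs)"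
      using len by (cases "xs = []") (auto simp: segment_convex_hull intro!: hull_mono)
    ultimately show ?thesis by (auto simp: boundary_def)
  qed
  have "set xs \<subseteq> boundary xs" using set_subset_polyline by (auto simp: boundary_def)
  then have hull: "convex hull (boundary xs) = convex hull (set xs)"
    using bd by (intro subset_antisym hull_minimal hull_mono) auto
  obtain v where v: "v extreme_point_of (convex hull (boundary xs))"
    unfolding hull
    by (rule extreme_point_exists_convex[of "convex hull (set xs)"])
       (use len in \<open>auto intro: finite_imp_compact_convex_hull\<close>)
  then have "v \<in> set xs" unfolding hull by (rule extreme_point_of_convex_hull)
  then obtain A B where AB: "xs = A @ v # B" by (meson split_list)
  define zs where "zs = B @ A"
  have Wz: "weak_polygon (v # zs)" using weak_polygon_rotate[of A "v # B"] W AB by (simp add: zs_def)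
  have bz: "boundary (v # zs) = boundary xs" using boundary_rotate[of A "v # B"] AB by (simp add: zs_def)
  have "3 \<le> length zs" using len AB by (simp add: zs_def)
  then obtain u ys w where zs: "zs = u # ys @ [w]" "ys \<noteq> []"
    by (cases zs; cases "tl zs" rule: rev_cases) (auto simp: Suc_le_eq)
  have W': "weak_polygon (v # u # ys @ [w])" and b': "boundary (v # u # ys @ [w]) = boundary xs"
    using Wz bz zs by auto
  have "set (v # zs) = set xs" using AB by (auto simp: zs_def)
  then have sets: "set (v # u # ys @ [w]) = set xs" unfolding zs(1) .
  note P = W'[unfolded weak_polygon_def]
  have wT: "w \<in> polyline (u # ys @ [w])" using set_subset_polyline[of "u # ys @ [w]"] by auto
  have d: "distinct (v # u # ys @ [w])" using P simple_polyline_distinct by blast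
  have 1: "closed_segment v u \<inter> polyline (u # ys @ [w]) = {u}" using P by simp
  have 2: "closed_segment w v \<inter> (closed_segment v u \<union> polyline (u # ys @ [w])) = {w, v}" using P by simp
  have "\<not> collinear {v, u, w}"
  proof
    assume "collinear {v, u, w}"
    then have "v \<in> closed_segment u w \<or> u \<in> closed_segment w v \<or> w \<in> closed_segment v u"
      by (simp add: collinear_between_cases between_mem_segment)
    moreover have "v \<notin> closed_segment u w"
    proof
      assume "v \<in> closed_segment u w"
      then have "v \<in> open_segment u w" using d by (auto simp: open_segment_def)
      moreover have "u \<in> set xs" "w \<in> set xs" using sets by auto
      then have "u \<in> convex hull (boundary xs)" "w \<in> convex hull (boundary xs)"
        unfolding hull by (auto intro: hull_inc)
      ultimately show False using v unfolding extreme_point_of_def by blast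
    qed
    moreover have "u \<notin> closed_segment w v"
    proof
      assume "u \<in> closed_segment w v"
      then have "u \<in> closed_segment w v \<inter> (closed_segment v u \<union> polyline (u # ys @ [w]))" by simp
      then show False unfolding 2 using d by auto
    qed
    moreover have "w \<notin> closed_segment v u"
    proof
      assume "w \<in> closed_segment v u"
      then have "w \<in> closed_segment v u \<inter> polyline (u # ys @ [w])" using wT by simp
      then show False unfolding 1 using d by auto
    qed
    ultimately show False by blast
  qed
  then obtain a b where "affine_frame v u w a b" by (rule affine_frame_exists)
  then interpret affine_frame v u w a b .
  interpret extreme_corner v u w a b ys
    by unfold_locales (use W' zs(2) v in \<open>simp_all only: b' not_False_eq_True\<close>)
  from diagonal_exists obtain p q where "p \<in> set xs" "q \<in> set xs" "p \<noteq> q"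
    "open_segment p q \<subseteq> inside (boundary xs)"
    unfolding b' sets by (elim bexE conjE)
  then show ?thesis by (rule that)
qed

section \<open>A triangle that splits the perimeter evenly\<close>

text \<open>
  Two corners joined by a side other than the base, or by a diagonal. Such segments lie in the region, and
  being linked is inherited from a piece to the whole polygon except along the cut, which is a
  diagonal.
\<close>

definition linked :: "complex list \<Rightarrow> complex \<Rightarrow> complex \<Rightarrow> bool" where
  "linked xs x y \<longleftrightarrow>
     (\<exists>L R. xs = L @ x # y # R) \<or> open_segment x y \<subseteq> inside (boundary xs)"

definition sees :: "complex list \<Rightarrow> complex \<Rightarrow> complex \<Rightarrow> bool" where
  "sees xs x y \<longleftrightarrow> closed_segment x y \<subseteq> boundary xs \<union> inside (boundary xs)"

lemma split_list_pair:
  assumes "p \<in> set xs" "q \<in> set xs" "p \<noteq> q"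
  obtains A B C p' q' where "xs = A @ p' # B @ q' # C" "p' = p \<and> q' = q \<or> p' = q \<and> q' = p"
proof -
  obtain A D where AD: "xs = A @ p # D" using split_list[OF assms(1)] by blast
  then consider "q \<in> set A" | "q \<in> set D" using assms by auto
  then show ?thesis
  proof cases
    case 1
    then obtain A' B where "A = A' @ q # B" by (meson split_list)
    then show ?thesis using AD that[of A' q B p D] by simp
  next
    case 2
    then obtain B C where "D = B @ q # C" by (meson split_list)
    then show ?thesis using AD that[of A p B q C] by simp
  qed
qed

lemma consecutive_imp_no_gap:
  assumes "distinct (A @ p # B @ q # C)" "A @ p # B @ q # C = L @ p # q # R"
  shows "B = []"
proof -
  have "p \<notin> set A" "p \<notin> set (B @ q # C)" using assms(1) by auto
  then have "B @ q # C = q # R"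
    using assms(2) append_Cons_eq_iff[of p A "B @ q # C" L "q # R"] by blast
  then show ?thesis using assms(1) by (cases B) auto
qed

lemma consecutive_after_shortcut:
  "A @ p # q # C = L @ x # y # R \<Longrightarrow>
    (\<exists>R'. A @ [p] = L @ x # y # R') \<or> (x = p \<and> y = q) \<or> (\<exists>L'. q # C = L' @ x # y # R)"
proof (induction A arbitrary: L)
  case Nil
  then show ?case by (cases L) auto
next
  case (Cons a A)
  show ?case
  proof (cases L)
    case Nil
    then show ?thesis using Cons.prems by (cases A) auto
  next
    case (Cons l L')
    then show ?thesis using Cons.prems Cons.IH[of L'] by auto
  qed
qed

lemma linked_shortcut:
  assumes link: "linked (A @ p # q # C) x y"
    and xs: "xs = A @ p # B @ q # C"
    and diag: "open_segment p q \<subseteq> inside (boundary xs)"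
    and sub: "inside (boundary (A @ p # q # C)) \<subseteq> inside (boundary xs)"
  shows "linked xs x y"
proof (cases "open_segment x y \<subseteq> inside (boundary xs)")
  case False
  then obtain L R where "A @ p # q # C = L @ x # y # R"
    using link sub by (auto simp: linked_def)
  from consecutive_after_shortcut[OF this] show ?thesis
  proof (elim disjE exE conjE)
    fix R' assume "A @ [p] = L @ x # y # R'"
    then have "xs = L @ x # y # (R' @ B @ q # C)" unfolding xs
      by (metis append.assoc append_Cons append_Nil)
    then show ?thesis unfolding linked_def by blast
  next
    fix L' assume "q # C = L' @ x # y # R"
    then have "xs = (A @ p # B @ L') @ x # y # R" unfolding xs by simp
    then show ?thesis unfolding linked_def by blast
  qed (use False diag in auto)
qed (simp add: linked_def)

text \<open>
  By induction along a diagonal: the piece that keeps the base has an apex, and its sides and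
  diagonals are sides or diagonals of the whole polygon.
\<close>

lemma weak_polygon_apex:
  assumes "weak_polygon xs"
  shows "\<exists>c\<in>set xs. c \<noteq> hd xs \<and> c \<noteq> last xs \<and> linked xs (hd xs) c \<and> linked xs c (last xs)"
  using assms
proof (induction xs rule: length_induct)
  case (1 xs)
  have len: "3 \<le> length xs" and dist: "distinct xs"
    using 1(2) simple_polyline_distinct by (auto simp: weak_polygon_def)
  show ?case
  proof (cases "length xs = 3")
    case True
    then obtain x c y where xs: "xs = [x, c, y]"
      by (auto simp: numeral_3_eq_3 length_Suc_conv)
    have "linked xs x c" "linked xs c y"
      unfolding linked_def xs by (auto intro: exI[of _ "[]"] exI[of _ "[x]"])
    then show ?thesis using dist unfolding xs by auto
  next
    case False
    then obtain p q where "p \<in> set xs" "q \<in> set xs" "p \<noteq> q"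
      "open_segment p q \<subseteq> inside (boundary xs)"
      using weak_polygon_diagonal[OF 1(2)] len by auto
    then obtain A B C p q where xs: "xs = A @ p # B @ q # C"
      and diag: "open_segment p q \<subseteq> inside (boundary xs)"
      using split_list_pair[of p xs q] open_segment_commute by metis
    note split = weak_polygon_split[OF 1(2) xs diag]
    let ?ys = "A @ p # q # C"
    obtain c where c: "c \<in> set ?ys" "c \<noteq> hd ?ys" "c \<noteq> last ?ys"
      "linked ?ys (hd ?ys) c" "linked ?ys c (last ?ys)"
      using 1(1) split(4,6) by blast
    have ends: "hd ?ys = hd xs" "last ?ys = last xs"
      unfolding xs by (simp_all add: hd_append)
    have "c \<in> set xs" using c(1) unfolding xs by auto
    moreover have "linked xs (hd xs) c" "linked xs c (last xs)"
      using c(4,5) linked_shortcut[OF _ xs diag split(5)] unfolding ends by auto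
    ultimately show ?thesis using c(2,3) unfolding ends by blast
  qed
qed

lemma polyline_mono: "polyline ys \<subseteq> polyline (xs @ ys @ zs)"
  by (cases "xs = []"; cases "ys = []"; cases "zs = []") (auto simp: polyline_append)

lemma linked_sees:
  assumes "linked xs x y" "x \<in> set xs" "y \<in> set xs"
  shows "sees xs x y"
proof -
  have "{x, y} \<subseteq> boundary xs"
    using assms(2,3) set_subset_polyline[of xs] by (auto simp: boundary_def)
  moreover have "closed_segment x y \<subseteq> boundary xs" if "xs = L @ x # y # R" for L R
    using edge_subset_polyline[of x y L R] unfolding that boundary_def by blast
  ultimately show ?thesis
    using assms(1) unfolding linked_def sees_def closed_segment_eq_open by blast
qed

text \<open>
  The boundary of the piece consists of part of the old boundary and the cut, which lies in the
  region.
\<close>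

lemma sees_sub_polygon:
  assumes "sees (p # B @ [q]) x y" "xs = A @ p # B @ q # C" "sees xs p q"
    "inside (boundary (p # B @ [q])) \<subseteq> inside (boundary xs)"
  shows "sees xs x y"
proof -
  have "polyline (p # B @ [q]) \<subseteq> boundary xs"
    using polyline_mono[of "p # B @ [q]" A C] assms(2) by (auto simp: boundary_def)
  moreover have "boundary (p # B @ [q]) = polyline (p # B @ [q]) \<union> closed_segment p q"
    by (simp add: boundary_def closed_segment_commute)
  ultimately show ?thesis using assms(1,3,4) unfolding sees_def by blast
qed

text \<open>
  The three corners are pairwise visible and divide the perimeter such that two arcs have at most
  \<open>s - 1\<close> sides each, but at least \<open>s\<close> together.
\<close>

lemma weak_polygon_balanced_triangle:
  assumes "weak_polygon xs" "2 \<le> s" "s < length xs"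
  shows "\<exists>A x B c C y D. xs = A @ x # B @ c # C @ y # D \<and>
     length B + 2 \<le> s \<and> length C + 2 \<le> s \<and> s \<le> length B + length C + 2 \<and>
     sees xs x c \<and> sees xs c y \<and> sees xs x y"
  using assms
proof (induction xs rule: length_induct)
  case (1 xs)
  have W: "weak_polygon xs" using 1 by simp
  have dist: "distinct xs" and len: "3 \<le> length xs"
    using W simple_polyline_distinct by (auto simp: weak_polygon_def)
  obtain c where c: "c \<in> set xs" "c \<noteq> hd xs" "c \<noteq> last xs"
    "linked xs (hd xs) c" "linked xs c (last xs)"
    using weak_polygon_apex[OF W] by blast
  obtain a M b where aMb: "xs = a # M @ [b]"
    using len by (cases xs; cases "tl xs" rule: rev_cases) auto
  then have "c \<in> set M" using c by auto
  then obtain B C where "M = B @ c # C" by (meson split_list)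
  then have xs: "xs = a # B @ c # C @ [b]" using aMb by simp
  have link: "linked xs a c" "linked xs c b" using c(4,5) unfolding xs by simp_all
  have sees: "sees xs a c" "sees xs c b"
    using link by (auto intro!: linked_sees simp: xs)
  have base: "sees xs a b"
    unfolding sees_def boundary_def by (simp add: xs closed_segment_commute) blast
  consider "s \<le> Suc (length B)" | "s \<le> Suc (length C)"
    | "length B + 2 \<le> s" "length C + 2 \<le> s" by linarith
  then show ?case
  proof cases
    case 1
    then have "B \<noteq> []" using \<open>2 \<le> s\<close> by auto
    have xs': "xs = [] @ a # B @ c # (C @ [b])" using xs by simp
    have "\<not> (\<exists>L R. xs = L @ a # c # R)"
      using consecutive_imp_no_gap[of "[]" a B c "C @ [b]"] dist \<open>B \<noteq> []\<close>
      unfolding xs'[symmetric] by metis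
    then have diag: "open_segment a c \<subseteq> inside (boundary xs)" using link(1) by (auto simp: linked_def)
    note split = weak_polygon_split[OF W xs' diag]
    obtain A x B' c' C' y D where *: "a # B @ [c] = A @ x # B' @ c' # C' @ y # D"
      "length B' + 2 \<le> s" "length C' + 2 \<le> s" "s \<le> length B' + length C' + 2"
      "sees (a # B @ [c]) x c'" "sees (a # B @ [c]) c' y" "sees (a # B @ [c]) x y"
      using "1.IH"[rule_format, OF split(3,1) \<open>2 \<le> s\<close>] 1 by auto
    have "xs = (a # B @ [c]) @ C @ [b]" using xs by simp
    then have "xs = A @ x # B' @ c' # C' @ y # (D @ C @ [b])" unfolding *(1) by simp
    then show ?thesis
      using *(2-4) sees_sub_polygon[OF _ xs' sees(1) split(2)] *(5-7) by blast
  next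
    case 2
    then have "C \<noteq> []" using \<open>2 \<le> s\<close> by auto
    have xs': "xs = (a # B) @ c # C @ b # []" using xs by simp
    have "\<not> (\<exists>L R. xs = L @ c # b # R)"
      using consecutive_imp_no_gap[of "a # B" c C b "[]"] dist \<open>C \<noteq> []\<close>
      unfolding xs'[symmetric] by metis
    then have diag: "open_segment c b \<subseteq> inside (boundary xs)" using link(2) by (auto simp: linked_def)
    note split = weak_polygon_split[OF W xs' diag]
    obtain A x B' c' C' y D where *: "c # C @ [b] = A @ x # B' @ c' # C' @ y # D"
      "length B' + 2 \<le> s" "length C' + 2 \<le> s" "s \<le> length B' + length C' + 2"
      "sees (c # C @ [b]) x c'" "sees (c # C @ [b]) c' y" "sees (c # C @ [b]) x y"
      using "1.IH"[rule_format, OF split(3,1) \<open>2 \<le> s\<close>] 2 by auto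
    have "xs = (a # B) @ (c # C @ [b])" using xs by simp
    then have "xs = ((a # B) @ A) @ x # B' @ c' # C' @ y # D" unfolding *(1) by simp
    then show ?thesis
      using *(2-4) sees_sub_polygon[OF _ xs' sees(2) split(2)] *(5-7) by blast
  next
    case 3
    have "s \<le> length B + length C + 2" using \<open>s < length xs\<close> by (simp add: xs)
    moreover have "xs = [] @ a # B @ c # C @ b # []" using xs by simp
    ultimately show ?thesis using 3 sees base by blast
  qed
qed

lemma polyline_nth:
  "2 \<le> length xs \<Longrightarrow> polyline xs = (\<Union>i<length xs - 1. closed_segment (xs ! i) (xs ! Suc i))"
proof (induction xs rule: polyline.induct)
  case (3 a b xs)
  have "(\<Union>i<length (a # b # xs) - 1. closed_segment ((a # b # xs) ! i) ((a # b # xs) ! Suc i))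
      = closed_segment a b \<union> (\<Union>i<length xs. closed_segment ((b # xs) ! i) (xs ! i))"
    by (simp add: lessThan_Suc_eq_insert_0)
  then show ?case
    using 3 by (cases xs) auto
qed auto

lemma simple_polyline_nth:
  assumes "distinct xs"
    and "\<And>i j. i < j \<Longrightarrow> Suc j < length xs \<Longrightarrow>
      closed_segment (xs ! i) (xs ! Suc i) \<inter> closed_segment (xs ! j) (xs ! Suc j)
        \<subseteq> (if j = Suc i then {xs ! j} else {})"
  shows "simple_polyline xs"
  using assms
proof (induction xs rule: polyline.induct)
  case (3 a b xs)
  have tail: "closed_segment ((b # xs) ! i) ((b # xs) ! Suc i) \<inter>
      closed_segment ((b # xs) ! j) ((b # xs) ! Suc j) \<subseteq> (if j = Suc i then {(b # xs) ! j} else {})"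
    if "i < j" "Suc j < length (b # xs)" for i j
    using 3(3)[of "Suc i" "Suc j"] that
    by (simp only: nth_Cons_Suc nat.inject length_Cons Suc_less_eq)
  have "simple_polyline (b # xs)"
    using 3(1)[OF _ tail] 3(2) by simp
  moreover have "closed_segment a b \<inter> polyline (b # xs) \<subseteq> {b}"
  proof (cases xs)
    case (Cons c ys)
    have "closed_segment a b \<inter> closed_segment ((b # xs) ! i) ((b # xs) ! Suc i) \<subseteq> {b}"
      if "i < length (b # xs) - 1" for i
    proof -
      have "closed_segment a b \<inter> closed_segment ((b # xs) ! i) ((b # xs) ! Suc i)
        \<subseteq> (if Suc i = Suc 0 then {(b # xs) ! i} else {})"
        using 3(3)[of 0 "Suc i"] that
        by (simp only: nth_Cons_Suc nth_Cons_0 length_Cons Suc_less_eq zero_less_Suc diff_Suc_1)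
      then show ?thesis by (auto split: if_splits)
    qed
    then show ?thesis
      using polyline_nth[of "b # xs"] Cons by auto
  qed auto
  moreover have "b \<in> polyline (b # xs)" using set_subset_polyline[of "b # xs"] by auto
  ultimately show ?case using 3(2) by auto
qed auto

text \<open>
  Connects the index-based definition of simple polygons with the recursive one used here.
\<close>

lemma simple_polygon_weak:
  assumes "simple_polygon P"
  shows "weak_polygon P" "boundary P = perimeter P"
proof -
  define n where "n = length P"
  have n: "3 \<le> n" and dist: "distinct P" using assms by (auto simp: simple_polygon_def n_def)
  have meet: "side P i \<inter> side P j = {corner P i, corner P (Suc i)} \<inter> {corner P j, corner P (Suc j)}"
    if "i < n" "j < n" "i \<noteq> j" for i j
    using assms that by (auto simp: simple_polygon_def n_def)
  have corner: "corner P i = P ! i" if "i < n" for i using that by (simp add: corner_def n_def)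
  have corner_n: "corner P n = P ! 0" by (simp add: corner_def n_def)
  have nth: "P ! i = P ! j \<longleftrightarrow> i = j" if "i < n" "j < n" for i j
    using dist that by (simp add: nth_eq_iff_index_eq n_def)
  have ends: "last P = P ! (n - 1)" "hd P = P ! 0"
  proof -
    have "P \<noteq> []" using n by (auto simp: n_def)
    then show "last P = P ! (n - 1)" "hd P = P ! 0"
      by (simp_all add: n_def last_conv_nth hd_conv_nth)
  qed
  have side: "side P i = closed_segment (P ! i) (P ! Suc i)" if "Suc i < n" for i
    using that corner by (simp add: side_def)
  have side_last: "side P (n - 1) = closed_segment (last P) (hd P)"
    using corner[of "n - 1"] corner_n n unfolding ends by (simp add: side_def)
  have pl: "polyline P = (\<Union>i<n - 1. side P i)"
    using polyline_nth[of P] n side by (simp add: n_def)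
  have "simple_polyline P"
  proof (rule simple_polyline_nth[OF dist])
    fix i j assume ij: "i < j" "Suc j < length P"
    have "closed_segment (P ! i) (P ! Suc i) \<inter> closed_segment (P ! j) (P ! Suc j)
        = {P ! i, P ! Suc i} \<inter> {P ! j, P ! Suc j}"
      using meet[of i j] ij side[of i] side[of j] corner by (simp add: n_def)
    also have "\<dots> \<subseteq> (if j = Suc i then {P ! j} else {})"
      using ij by (auto simp: nth n_def[symmetric])
    finally show "closed_segment (P ! i) (P ! Suc i) \<inter> closed_segment (P ! j) (P ! Suc j)
        \<subseteq> (if j = Suc i then {P ! j} else {})" .
  qed
  moreover have "closed_segment (last P) (hd P) \<inter> polyline P = {last P, hd P}"
  proof
    show "closed_segment (last P) (hd P) \<inter> polyline P \<subseteq> {last P, hd P}"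
    proof
      fix z assume z: "z \<in> closed_segment (last P) (hd P) \<inter> polyline P"
      then obtain i where i: "i < n - 1" "z \<in> side P i" unfolding pl by auto
      then have "z \<in> side P i \<inter> side P (n - 1)" using z side_last by simp
      also have "\<dots> \<subseteq> {corner P (n - 1), corner P (Suc (n - 1))}"
        using meet[of i "n - 1"] i n by auto
      finally show "z \<in> {last P, hd P}"
        using corner[of "n - 1"] corner_n n unfolding ends by simp
    qed
    show "{last P, hd P} \<subseteq> closed_segment (last P) (hd P) \<inter> polyline P"
      using n hd_in_polyline[of P] last_in_polyline[of P] by (cases "P = []") (auto simp: n_def)
  qed
  ultimately show "weak_polygon P" using n by (simp add: weak_polygon_def n_def)
  have "{..<n} = insert (n - 1) {..<n - 1}" using n by auto
  then show "boundary P = perimeter P"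
    unfolding boundary_def perimeter_def pl side_last[symmetric] n_def[symmetric] by auto
qed

section \<open>Guards on a cycle with one chord triangle\<close>

lemma reach_within:
  fixes seen :: "nat \<Rightarrow> bool"
  assumes "seen t" "i \<le> t" "t < i + m"
  shows "\<exists>j<m. seen (i + j)"
  using assms by (intro exI[of _ "t - i"]) auto

text \<open>
  The corners of a polygon as positions on a cycle of length \<open>n\<close>. Positions are natural numbers read
  modulo \<open>n\<close>, which avoids modular arithmetic for windows that run past position \<open>n\<close>: these reach
  position \<open>n\<close>, which is \<open>0\<close> again. The guards to be placed have to see a position in every window of
  \<open>s - 2 = k + 2\<close> consecutive ones, and \<open>q\<close> of them are allowed.
\<close>

locale cyclic_visibility =
  fixes V :: "nat \<Rightarrow> nat \<Rightarrow> bool" and n s :: nat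
  assumes s: "3 \<le> s" "s \<le> n"
    and V_refl: "V u u" and V_Suc: "V u (Suc u)" and V_pred: "V (Suc u) u"
    and V_period: "V u (v + n) \<longleftrightarrow> V u v" "V (u + n) v \<longleftrightarrow> V u v"
begin

abbreviation q :: nat where "q \<equiv> n div s"
abbreviation r :: nat where "r \<equiv> n mod s"

lemma n_eq: "n = (q - 1) * s + s + r" and r_less: "r < s" and q_pos: "1 \<le> q"
proof -
  show q: "1 \<le> q" using s by (simp add: Suc_le_eq div_greater_zero_iff)
  show "r < s" using s by simp
  have "n = q * s + r" by simp
  then show "n = (q - 1) * s + s + r" using q by (cases q) auto
qed

lemma V_n: "V u n \<longleftrightarrow> V u 0" "V n v \<longleftrightarrow> V 0 v"
  using V_period[of u 0] V_period[of 0 v] by auto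

definition suffices :: bool where
  "suffices \<longleftrightarrow> (\<exists>U. finite U \<and> card U \<le> q \<and> (\<forall>i<n. \<exists>j<s - 2. \<exists>u\<in>U. V u (i + j)))"

lemma block_decomposition:
  obtains a b where "d = a * s + b" "b < s"
  using s by (metis add.commute div_mult_mod_eq mod_less_divisor not_numeral_le_zero order_less_le_trans zero_less_numeral)

lemma block_less: "d < c * s \<Longrightarrow> d = a * s + b \<Longrightarrow> a < c"
  by (metis add_lessD1 mult_less_cancel2)

text \<open>
  The corners of the triangle are \<open>0\<close>, \<open>p\<close> and \<open>e\<close>. The guard at \<open>p\<close> leaves runs of at most \<open>s - 3\<close>
  unseen positions between \<open>0\<close> and \<open>e\<close>. The other \<open>q - 1\<close> guards go back from \<open>n\<close> in steps of \<open>s\<close>.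
  As \<open>n\<close>, which is \<open>0\<close>, is seen from \<open>p\<close> already, the first of them can stand at \<open>n + 1 - s\<close>, so that they reach down
  to \<open>n - (q - 1) * s = s + r\<close>, and at most \<open>s - 3\<close> positions between there and \<open>e\<close> remain unseen
  because \<open>e > s\<close>.
\<close>

lemma suffices_wide:
  assumes "0 < p" "p < s" "p < e" "e < p + s" "s < e" "e < n" "V p 0" "V p e"
  shows suffices
proof -
  define U where "U = insert p ((\<lambda>j. n + 1 - j * s) ` {1..<q})"
  have "card U \<le> Suc (card ((\<lambda>j. n + 1 - j * s) ` {1..<q}))"
    unfolding U_def by (rule card_insert_le_m1) simp_all
  also have "\<dots> \<le> Suc (card {1..<q})" using card_image_le by blast
  also have "\<dots> = q" using q_pos by simp
  finally have card: "card U \<le> q" .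
  let ?seen = "\<lambda>t. \<exists>u\<in>U. V u t"
  have seen_p: "?seen p" "?seen (p - 1)" "?seen (Suc p)" "?seen e" "?seen n" "?seen 0"
    using assms V_pred[of "p - 1"] V_refl V_Suc V_n by (auto simp: U_def)
  have mult_le: "j * s + s + r \<le> n" if "j < q" for j
  proof -
    have "j * s \<le> (q - 1) * s" using that by (intro mult_right_mono) auto
    then show ?thesis using n_eq by linarith
  qed
  have seen_block: "?seen (n - j * s)" "?seen (n + 1 - j * s)" "?seen (n + 2 - j * s)"
    if j: "1 \<le> j" "j < q" for j
  proof -
    have U: "n + 1 - j * s \<in> U" using j by (auto simp: U_def)
    have "n + 1 - j * s = Suc (n - j * s)" "n + 2 - j * s = Suc (n + 1 - j * s)"
      using mult_le[OF j(2)] by auto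
    then show "?seen (n - j * s)" "?seen (n + 1 - j * s)" "?seen (n + 2 - j * s)"
      using U V_refl V_Suc V_pred by metis+
  qed
  have seen_mult: "?seen (n - j * s)" if "j < q" for j
    using seen_block(1)[of j] seen_p(5) that by (cases "j = 0") auto
  have "\<exists>j<s - 2. ?seen (i + j)" if "i < n" for i
  proof -
    consider "i = 0" | "0 < i" "i < p" | "i = p" | "i = Suc p" | "Suc p < i" "i \<le> e"
      | "e < i" "i \<le> n - (q - 1) * s" | "e < i" "n - (q - 1) * s < i" by linarith
    then show ?thesis
    proof cases
      case 1 then show ?thesis using seen_p(6) s by (intro reach_within[of _ 0]) auto
    next
      case 2 then show ?thesis using seen_p(2) s assms by (intro reach_within[of _ "p - 1"]) auto
    next
      case 3 then show ?thesis using seen_p(1) s by (intro reach_within[of _ p]) auto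
    next
      case 4 then show ?thesis using seen_p(3) s by (intro reach_within[of _ "Suc p"]) auto
    next
      case 5 then show ?thesis using seen_p(4) s assms by (intro reach_within[of _ e]) auto
    next
      case 6
      have "n - (q - 1) * s = s + r" using n_eq by linarith
      then have "n - (q - 1) * s < i + (s - 2)" using 6 r_less assms by linarith
      then show ?thesis
        using 6 q_pos by (intro reach_within[of _ "n - (q - 1) * s"] seen_mult) auto
    next
      case 7
      obtain a b where ab: "n - i = a * s + b" "b < s" by (rule block_decomposition)
      have "n - i < (q - 1) * s" using 7 that by linarith
      then have a: "a < q - 1" using block_less ab(1) by blast
      have i: "i = n - (a * s + b)" "a * s + b \<le> n" using ab that by linarith+
      have le: "a * s + s \<le> n" using mult_le[of a] a by linarith
      consider "b < s - 2" | "b = s - 2" | "b = s - 1" using ab(2) by linarith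
      then show ?thesis
      proof cases
        case 1
        then show ?thesis using a i by (intro reach_within[of _ "n - a * s"] seen_mult) auto
      next
        case 2
        then have "i = n + 2 - (a + 1) * s" using i s le by (simp add: algebra_simps)
        then show ?thesis
          using seen_block(3)[of "a + 1"] a s by (intro reach_within[of _ i]) auto
      next
        case 3
        then have "i = n + 1 - (a + 1) * s" using i s le by (simp add: algebra_simps)
        then show ?thesis
          using seen_block(2)[of "a + 1"] a s by (intro reach_within[of _ i]) auto
      qed
    qed
  qed
  then show ?thesis unfolding suffices_def using card by (intro exI[of _ U]) (auto simp: U_def)
qed

text \<open>
  For \<open>e = s\<close> the guard stands at position \<open>0\<close>, the same as \<open>n\<close>, and the others follow backwards in
  steps of \<open>s\<close>. This guard does not see the neighbours of \<open>p\<close>, so the run between \<open>p\<close> and \<open>s\<close> is short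
  enough only for \<open>p \<ge> 2\<close>.
\<close>

lemma suffices_tight_first:
  assumes "2 \<le> p" "p < s" "s < n" "V 0 p" "V 0 s"
  shows suffices
proof -
  define U where "U = (\<lambda>j. n - j * s) ` {..<q}"
  have card: "card U \<le> q" unfolding U_def using card_image_le[of "{..<q}"] by fastforce
  let ?seen = "\<lambda>t. \<exists>u\<in>U. V u t"
  have mult_le: "j * s + s + r \<le> n" if "j < q" for j
  proof -
    have "j * s \<le> (q - 1) * s" using that by (intro mult_right_mono) auto
    then show ?thesis using n_eq by linarith
  qed
  have seen_block: "?seen (n - j * s - 1)" "?seen (n - j * s)" "?seen (n + 1 - j * s)"
    if j: "j < q" for j
  proof -
    have U: "n - j * s \<in> U" using j by (auto simp: U_def)
    have "n + 1 - j * s = Suc (n - j * s)" "n - j * s = Suc (n - j * s - 1)"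
      using mult_le[OF j] s by auto
    then show "?seen (n - j * s - 1)" "?seen (n - j * s)" "?seen (n + 1 - j * s)"
      using U V_refl V_Suc V_pred by metis+
  qed
  have "n \<in> U" using q_pos by (auto simp: U_def intro!: image_eqI[of _ _ 0])
  then have seen_n: "?seen 0" "?seen 1" "?seen p" "?seen s"
    using V_refl[of 0] V_Suc[of 0] assms V_n by (auto intro!: bexI[of _ n])
  have "\<exists>j<s - 2. ?seen (i + j)" if "i < n" for i
  proof -
    consider "i = 0" | "i = 1" | "1 < i" "i \<le> p" | "p < i" "i \<le> s"
      | "s < i" "i < n - (q - 1) * s" | "s < i" "n - (q - 1) * s \<le> i" by linarith
    then show ?thesis
    proof cases
      case 1 then show ?thesis using seen_n s by (intro reach_within[of _ 0]) auto
    next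
      case 2 then show ?thesis using seen_n s by (intro reach_within[of _ 1]) auto
    next
      case 3 then show ?thesis using seen_n s assms by (intro reach_within[of _ p]) auto
    next
      case 4 then show ?thesis using seen_n s assms by (intro reach_within[of _ s]) auto
    next
      case 5
      have "n - (q - 1) * s = s + r" using n_eq by linarith
      then have "n - (q - 1) * s - 1 < i + (s - 2)" using 5 r_less by linarith
      then show ?thesis
        using 5 q_pos by (intro reach_within[of _ "n - (q - 1) * s - 1"] seen_block) auto
    next
      case 6
      obtain a b where ab: "n - i = a * s + b" "b < s" by (rule block_decomposition)
      have d: "n - i \<le> (q - 1) * s" using 6 by linarith
      then have "n - i < q * s" using s q_pos by (cases q) auto
      then have a: "a < q" using block_less ab(1) by blast
      have i: "i = n - (a * s + b)" "a * s + b \<le> n" using ab that by linarith+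
      have le: "a * s + s \<le> n" using mult_le[of a] a by linarith
      consider "b = 0" | "1 \<le> b" "b \<le> s - 2" | "b = s - 1" using ab(2) by linarith
      then show ?thesis
      proof cases
        case 1
        then show ?thesis using a i s by (intro reach_within[of _ "n - a * s"] seen_block) auto
      next
        case 2
        then show ?thesis using a i s le by (intro reach_within[of _ "n - a * s - 1"] seen_block) auto
      next
        case 3
        then have "a * s < (q - 1) * s" using d ab(1) s by linarith
        then have "a < q - 1" by simp
        then have "a + 1 < q" by linarith
        moreover have "i = n + 1 - (a + 1) * s" using 3 i s le by (simp add: algebra_simps)
        ultimately show ?thesis
          using seen_block(3)[of "a + 1"] s by (intro reach_within[of _ i]) auto
      qed
    qed
  qed
  then show ?thesis unfolding suffices_def using card by (intro exI[of _ U]) (auto simp: U_def)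
qed

text \<open>
  The remaining case \<open>p = 1\<close>, \<open>e = s\<close>: the guard stands at \<open>s\<close> and the others follow forwards. That
  the first guard sees \<open>0\<close>, which is \<open>n\<close> again, closes the gap after the last guard.
\<close>

lemma suffices_tight_last:
  assumes "s < n" "V s 0" "V s 1"
  shows suffices
proof -
  define U where "U = (\<lambda>j. j * s) ` {1..q}"
  have card: "card U \<le> q" unfolding U_def using card_image_le[of "{1..q}"] by fastforce
  let ?seen = "\<lambda>t. \<exists>u\<in>U. V u t"
  have seen_block: "?seen (j * s - 1)" "?seen (j * s)" "?seen (j * s + 1)"
    if j: "1 \<le> j" "j \<le> q" for j
  proof -
    have U: "j * s \<in> U" using j by (auto simp: U_def)
    have "j * s + 1 = Suc (j * s)" "j * s = Suc (j * s - 1)"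
      using j s by auto
    then show "?seen (j * s - 1)" "?seen (j * s)" "?seen (j * s + 1)"
      using U V_refl V_Suc V_pred by metis+
  qed
  have "s \<in> U" using q_pos by (auto simp: U_def intro!: image_eqI[of _ _ 1])
  then have seen: "?seen 0" "?seen 1" "?seen n" using assms V_n by auto
  have "\<exists>j<s - 2. ?seen (i + j)" if "i < n" for i
  proof -
    obtain a b where ab: "i = a * s + b" "b < s" by (rule block_decomposition)
    have n: "n = q * s + r" by simp
    moreover have "(q + 1) * s = q * s + s" by simp
    ultimately have "i < (q + 1) * s" using that r_less by linarith
    then have "a < q + 1" using block_less ab(1) by blast
    then consider "a = 0" "b \<le> 1" | "1 \<le> a" "a \<le> q" "b \<le> 1" | "a < q" "2 \<le> b" | "a = q" "2 \<le> b"
      by linarith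
    then show ?thesis
    proof cases
      case 1
      then have "i = 0 \<or> i = 1" using ab by auto
      then show ?thesis using seen s by (intro reach_within[of _ i]) auto
    next
      case 2
      then have "i = a * s \<or> i = a * s + 1" using ab by auto
      then have "?seen i" using seen_block[of a] 2 by auto
      then show ?thesis using s by (intro reach_within[of _ i]) auto
    next
      case 3
      have "(a + 1) * s - 1 = a * s + s - 1" by simp
      then show ?thesis
        using seen_block(1)[of "a + 1"] 3 ab s by (intro reach_within[of _ "(a + 1) * s - 1"]) auto
    next
      case 4
      have "n < i + (s - 2)" using n 4 ab r_less s unfolding 4(1) by linarith
      then show ?thesis using seen(3) that by (intro reach_within[of _ n]) auto
    qed
  qed
  then show ?thesis unfolding suffices_def using card by (intro exI[of _ U]) (auto simp: U_def)
qed

text \<open>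
  One guard at \<open>0\<close> sees \<open>n - 1\<close>, \<open>0\<close> and \<open>1\<close>, which leaves \<open>s - 3\<close> positions.
\<close>

lemma suffices_single:
  assumes "n = s"
  shows suffices
proof -
  have "V 0 (n - 1)" using V_pred[of "n - 1"] V_n s assms by simp
  moreover have "V 0 0" "V 0 1" using V_refl[of 0] V_Suc[of 0] by auto
  ultimately have "\<exists>j<s - 2. V 0 (i + j)" if "i < n" for i
  proof -
    consider "i = 0" | "i = 1" | "2 \<le> i" by linarith
    then show ?thesis
    proof cases
      case 3 then show ?thesis using \<open>V 0 (n - 1)\<close> that s assms by (intro reach_within[of _ "n - 1"]) auto
    next
      case 1 then show ?thesis using \<open>V 0 0\<close> s by (intro reach_within[of _ 0]) auto
    next
      case 2 then show ?thesis using \<open>V 0 1\<close> s by (intro reach_within[of _ 1]) auto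
    qed
  qed
  then show ?thesis
    unfolding suffices_def using assms s by (intro exI[of _ "{0}"]) auto
qed

lemma suffices_triangle:
  assumes "0 < p" "p < s" "p < e" "e < p + s" "s \<le> e" "e < n"
    and "V p 0" "V p e" "V 0 p" "V 0 e" "V e 0" "V e p"
  shows suffices
proof -
  consider "s < e" | "e = s" "2 \<le> p" | "e = s" "p = 1" using assms by linarith
  then show ?thesis
    using suffices_wide[of p e] suffices_tight_first[of p] suffices_tight_last assms by cases auto
qed

end

section \<open>The upper bound\<close>

lemma sees_visible:
  assumes "sees P x y" "boundary P = perimeter P"
  shows "visible P x y"
proof -
  have "closed_segment x y \<subseteq> region P"
    using assms unfolding sees_def region_def by simp
  moreover have "region P \<inter> exterior P = {}"
    using union_with_inside[of "perimeter P"] by (auto simp: region_def exterior_def)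
  ultimately show ?thesis unfolding visible_def by (meson disjoint_iff ends_in_segment subsetD)
qed

lemma visible_commute: "visible P x y \<longleftrightarrow> visible P y x"
  by (auto simp: visible_def closed_segment_commute)

lemma corner_add_length: "corner P (i + length P) = corner P i"
  by (simp add: corner_def)

lemma side_subset_perimeter:
  assumes "P \<noteq> []" shows "side P i \<subseteq> perimeter P"
proof -
  have "side P i = side P (i mod length P)"
    by (simp add: side_def corner_def mod_Suc_eq)
  then show ?thesis using assms unfolding perimeter_def by fastforce
qed

lemma side_visible:
  assumes "P \<noteq> []"
  shows "visible P (corner P i) (corner P (Suc i))" "visible P (corner P i) (corner P i)"
proof -
  have "region P \<inter> exterior P = {}"
    using union_with_inside[of "perimeter P"] by (auto simp: region_def exterior_def)
  moreover have "side P i \<subseteq> region P" using side_subset_perimeter[OF assms] by (auto simp: region_def)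
  ultimately have 1: "side P i \<inter> exterior P = {}" "side P i \<subseteq> region P" by auto
  moreover have "corner P i \<in> side P i" "corner P (Suc i) \<in> side P i" by (simp_all add: side_def)
  ultimately show "visible P (corner P i) (corner P (Suc i))" "visible P (corner P i) (corner P i)"
    unfolding visible_def side_def by auto
qed

lemma cyclic_visibility_polygon:
  assumes "3 \<le> s" "s \<le> length P"
  shows "cyclic_visibility (\<lambda>u v. visible P (corner P (off0 + u)) (corner P (off0 + v))) (length P) s"
proof -
  have ne: "P \<noteq> []" using assms by auto
  have per: "corner P (off0 + (v + length P)) = corner P (off0 + v)" for v
    using corner_add_length[of P "off0 + v"] by (simp add: add.assoc)
  show ?thesis
  proof
    fix u v
    show "visible P (corner P (off0 + Suc u)) (corner P (off0 + u))"
      using side_visible(1)[OF ne, of "off0 + u"] by (simp add: visible_commute)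
  qed (use assms side_visible[OF ne] in \<open>simp_all add: per\<close>)
qed

lemma guard_number_le:
  assumes "guards k P G" shows "guard_number k P \<le> card G"
  unfolding guard_number_def by (rule Least_le) (use assms in blast)

text \<open>
  The positions of the cyclic problem are counted from the first corner of the balanced triangle.
\<close>

lemma guard_number_upper_bound:
  fixes k :: int
  assumes k: "-1 \<le> k" and P: "simple_polygon P" and n: "nat (k + 4) \<le> length P"
  shows "guard_number k P \<le> length P div nat (k + 4)"
proof -
  define s where "s = nat (k + 4)"
  define n where "n = length P"
  have s: "3 \<le> s" "s \<le> n" using k n by (auto simp: s_def n_def)
  note weak = simple_polygon_weak[OF P]
  have ne: "P \<noteq> []" using s by (auto simp: n_def)
  have "\<exists>off0<n. cyclic_visibility.suffices (\<lambda>u v. visible P (corner P (off0 + u)) (corner P (off0 + v))) n s"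
  proof (cases "s = n")
    case True
    interpret cyclic_visibility "\<lambda>u v. visible P (corner P (0 + u)) (corner P (0 + v))" n s
      using cyclic_visibility_polygon s unfolding n_def .
    show ?thesis using suffices_single True s by (intro exI[of _ 0]) auto
  next
    case False
    then obtain A x B c C y D where xs: "P = A @ x # B @ c # C @ y # D"
      and len: "length B + 2 \<le> s" "length C + 2 \<le> s" "s \<le> length B + length C + 2"
      and sees: "sees P x c" "sees P c y" "sees P x y"
      using weak_polygon_balanced_triangle[OF weak(1), of s] s by (auto simp: n_def)
    define off0 p e where "off0 = length A" and "p = Suc (length B)" and "e = p + Suc (length C)"
    have e: "off0 + e < n" unfolding n_def xs by (simp add: off0_def p_def e_def)
    have "P ! (off0 + 0) = x" unfolding xs off0_def by simp
    moreover have "P = (A @ x # B) @ c # C @ y # D" "P = (A @ x # B @ c # C) @ y # D"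
      unfolding xs by simp_all
    then have "P ! length (A @ x # B) = c" "P ! length (A @ x # B @ c # C) = y"
      by (metis nth_append_length)+
    then have "P ! (off0 + p) = c" "P ! (off0 + e) = y" by (simp_all add: off0_def p_def e_def)
    ultimately have corner: "corner P (off0 + 0) = x" "corner P (off0 + p) = c" "corner P (off0 + e) = y"
      using e by (simp_all add: corner_def n_def e_def)
    have vis: "visible P x c" "visible P c y" "visible P x y" "visible P c x" "visible P y c" "visible P y x"
      using sees sees_visible[OF _ weak(2)] visible_commute by blast+
    interpret cyclic_visibility "\<lambda>u v. visible P (corner P (off0 + u)) (corner P (off0 + v))" n s
      using cyclic_visibility_polygon s unfolding n_def .
    have suffices
    proof (rule suffices_triangle[of p e])
      show "0 < p" "p < s" "p < e" "e < p + s" "s \<le> e" "e < n"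
        using len e by (simp_all add: p_def e_def)
    qed (simp_all only: corner vis)
    then show ?thesis using e by (intro exI[of _ off0]) auto
  qed
  then obtain off0 where off0: "off0 < n"
    and suff: "cyclic_visibility.suffices (\<lambda>u v. visible P (corner P (off0 + u)) (corner P (off0 + v))) n s"
    by blast
  interpret cyclic_visibility "\<lambda>u v. visible P (corner P (off0 + u)) (corner P (off0 + v))" n s
    using cyclic_visibility_polygon s unfolding n_def .
  obtain U where U: "finite U" "card U \<le> n div s"
    "\<And>i. i < n \<Longrightarrow> \<exists>j<s - 2. \<exists>u\<in>U. visible P (corner P (off0 + u)) (corner P (off0 + (i + j)))"
    using suff unfolding suffices_def by blast
  define G where "G = (\<lambda>u. corner P (off0 + u)) ` U"
  have "guards k P G"
    unfolding guards_def
  proof (intro conjI allI impI)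
    show "finite G" using U by (simp add: G_def)
    show "G \<subseteq> region P" using side_visible(2)[OF ne] by (auto simp: G_def visible_def)
    fix i assume i: "i < length P"
    \<comment> \<open>The window starts at i; relative to the offset this is position i - off0, read modulo n.\<close>
    define i' where "i' = (if off0 \<le> i then i - off0 else i + n - off0)"
    have "i' < n" using i off0 by (auto simp: i'_def n_def)
    then obtain j u where j: "j < s - 2" "u \<in> U"
      "visible P (corner P (off0 + u)) (corner P (off0 + (i' + j)))" using U(3) by blast
    have "corner P (off0 + (i' + j)) = corner P (i + j)"
    proof (cases "off0 \<le> i")
      case False
      then have "off0 + (i' + j) = (i + j) + length P" using off0 by (simp add: i'_def n_def)
      then show ?thesis using corner_add_length[of P "i + j"] by metis
    qed (simp add: i'_def)
    then show "\<exists>j. int j < k + 2 \<and> (\<exists>g\<in>G. visible P g (corner P (i + j)))"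
      using j k by (intro exI[of _ j]) (auto simp: G_def s_def)
  qed
  then have "guard_number k P \<le> card G" by (rule guard_number_le)
  also have "\<dots> \<le> card U" unfolding G_def using U(1) by (rule card_image_le)
  finally show ?thesis using U(2) by (simp add: n_def s_def)
qed

section \<open>A comb that needs one guard per tooth\<close>

lemma collinear_cross:
  assumes "collinear {a, b, c}"
  shows "Re (b - a) * Im (c - a) = Im (b - a) * Re (c - a)"
proof -
  obtain u where u: "\<And>x y. x \<in> {a, b, c} \<Longrightarrow> y \<in> {a, b, c} \<Longrightarrow> \<exists>r. x - y = r *\<^sub>R u"
    using assms unfolding collinear_def by blast
  obtain r r' where "b - a = r *\<^sub>R u" "c - a = r' *\<^sub>R u" using u[of b a] u[of c a] by auto
  then show ?thesis by simp
qed

text \<open>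
  A polygon whose upper boundary is the graph of a piecewise linear function with nodes at the
  integers \<open>0, \<dots>, n - 1\<close>, and whose remaining side lies on the real axis. For these both simplicity
  and the exterior are easy to control: sides are compared by real parts, and points above the graph
  escape vertically. The last assumption says that consecutive slopes differ.
\<close>

locale graph_polygon =
  fixes n :: nat and Y :: "nat \<Rightarrow> real"
  assumes n: "3 \<le> n" and Y_first: "Y 0 = 0" and Y_last: "Y (n - 1) = 0"
    and Y_pos: "0 < i \<Longrightarrow> i < n - 1 \<Longrightarrow> 0 < Y i"
    and Y_bend: "i + 2 < n \<Longrightarrow> Y i - 2 * Y (i + 1) + Y (i + 2) \<noteq> 0"
begin

definition polygon :: "complex list" where
  "polygon = map (\<lambda>i. Complex (real i) (Y i)) [0..<n]"

lemma length_polygon_graph [simp]: "length polygon = n"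
  by (simp add: polygon_def)

lemma distinct_polygon_graph: "distinct polygon"
  unfolding polygon_def distinct_map by (auto simp: inj_on_def)

lemma corner_polygon_graph: "i < n \<Longrightarrow> corner polygon i = Complex (real i) (Y i)"
  by (simp add: corner_def polygon_def)

lemma corner_polygon_graph_wrap: "corner polygon n = Complex 0 0" "corner polygon (Suc n) = Complex 1 (Y 1)"
  using n corner_polygon_graph[of 0] corner_polygon_graph[of 1] Y_first by (simp_all add: corner_def mod_Suc)

lemma Y_nonneg: "i < n \<Longrightarrow> 0 \<le> Y i"
proof -
  assume "i < n"
  then consider "i = 0" | "0 < i" "i < n - 1" | "i = n - 1" by linarith
  then show ?thesis using Y_pos[of i] Y_first Y_last by cases auto
qed

lemma upper_side_point:
  assumes "z \<in> side polygon i" "i + 1 < n"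
  obtains r where "0 \<le> r" "r \<le> 1" "Re z = real i + r" "Im z = (1 - r) * Y i + r * Y (i + 1)"
proof -
  have "z \<in> closed_segment (Complex (real i) (Y i)) (Complex (real (i + 1)) (Y (i + 1)))"
    using assms corner_polygon_graph[of i] corner_polygon_graph[of "i + 1"] by (simp add: side_def)
  then obtain r where r: "0 \<le> r" "r \<le> 1"
    "z = (1 - r) *\<^sub>R Complex (real i) (Y i) + r *\<^sub>R Complex (real (i + 1)) (Y (i + 1))"
    unfolding in_segment by blast
  have "Re z = real i + r" "Im z = (1 - r) * Y i + r * Y (i + 1)"
    unfolding r(3) by (simp_all add: algebra_simps)
  then show ?thesis using that r by blast
qed

lemma lower_side_point: "z \<in> side polygon (n - 1) \<Longrightarrow> Im z = 0"
  using corner_polygon_graph[of "n - 1"] corner_polygon_graph_wrap n Y_last by (auto simp: side_def in_segment)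

lemma upper_side_nonneg: "z \<in> side polygon i \<Longrightarrow> i + 1 < n \<Longrightarrow> 0 \<le> Im z"
  using Y_nonneg[of i] Y_nonneg[of "i + 1"] by (elim upper_side_point) auto

lemma sides_meet:
  assumes "i < j" "j < n" "z \<in> side polygon i" "z \<in> side polygon j"
  shows "z \<in> {corner polygon i, corner polygon (Suc i)} \<inter> {corner polygon j, corner polygon (Suc j)}"
proof -
  have "i + 1 < n" using assms by simp
  then obtain r where r: "0 \<le> r" "r \<le> 1" "Re z = real i + r" "Im z = (1 - r) * Y i + r * Y (i + 1)"
    using upper_side_point[OF assms(3)] by metis
  show ?thesis
  proof (cases "j = n - 1")
    case False
    then have "j + 1 < n" using assms by simp
    then obtain r' where r': "0 \<le> r'" "Re z = real j + r'" "Im z = (1 - r') * Y j + r' * Y (j + 1)"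
      using upper_side_point[OF assms(4)] by metis
    have "real i + 1 \<le> real j" using assms(1) by linarith
    then have "real j = real (i + 1)" "r' = 0" "r = 1" using r(1-3) r'(1,2) by linarith+
    then have "j = i + 1" "z = corner polygon j"
      using r'(2,3) corner_polygon_graph[of j] assms by (auto simp: complex_eq_iff)
    then show ?thesis by simp
  next
    case True
    then have Im: "(1 - r) * Y i + r * Y (i + 1) = 0"
      using lower_side_point assms(4) r(4) by simp
    have nonneg: "0 \<le> Y i" "0 \<le> Y (i + 1)" using Y_nonneg assms by auto
    then have "(1 - r) * Y i = 0 \<and> r * Y (i + 1) = 0"
      using Im r(1,2) by (subst (asm) add_nonneg_eq_0_iff) auto
    then have cases: "(r = 1 \<or> Y i = 0) \<and> (r = 0 \<or> Y (i + 1) = 0)" by auto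
    have "Y i = 0 \<Longrightarrow> i = 0" "Y (i + 1) = 0 \<Longrightarrow> i + 1 = n - 1"
      using Y_pos[of i] Y_pos[of "i + 1"] assms True by (auto simp: not_less) force+
    then consider "r = 1" "i + 1 = n - 1" | "r = 0" "i = 0" | "i = 0" "i + 1 = n - 1"
      using cases by auto
    then show ?thesis
    proof cases
      case 1
      then have "z = corner polygon (Suc i)"
        using r corner_polygon_graph[of "i + 1"] n by (simp add: complex_eq_iff)
      then show ?thesis using 1 True by simp
    next
      case 2
      then have "z = corner polygon i" "corner polygon i = corner polygon (Suc j)"
        using r corner_polygon_graph[of 0] n Y_first corner_polygon_graph_wrap True by (simp_all add: complex_eq_iff)
      then show ?thesis by simp
    next
      case 3 then show ?thesis using n by simp
    qed
  qed
qed

lemma simple_polygon_graph: "simple_polygon polygon"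
  unfolding simple_polygon_def length_polygon_graph
proof (intro conjI allI impI)
  show "3 \<le> n" by (rule n)
  show "distinct polygon" by (rule distinct_polygon_graph)
  fix i j assume ij: "i < n" "j < n" "i \<noteq> j"
  have "{corner polygon i, corner polygon (Suc i)} \<inter> {corner polygon j, corner polygon (Suc j)}
      \<subseteq> side polygon i \<inter> side polygon j" by (auto simp: side_def)
  moreover have "side polygon i \<inter> side polygon j
      \<subseteq> {corner polygon i, corner polygon (Suc i)} \<inter> {corner polygon j, corner polygon (Suc j)}"
  proof (cases "i < j")
    case True
    then show ?thesis using sides_meet ij(2) by blast
  next
    case False
    then have "j < i" using ij by simp
    then show ?thesis using sides_meet ij(1) by blast
  qed
  ultimately show "side polygon i \<inter> side polygon j =
      {corner polygon i, corner polygon (Suc i)} \<inter> {corner polygon j, corner polygon (Suc j)}" by (rule subset_antisym[rotated])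
next
  fix i assume i: "i < n"
  show "\<not> collinear {corner polygon i, corner polygon (Suc i), corner polygon (Suc (Suc i))}"
  proof
    assume col: "collinear {corner polygon i, corner polygon (Suc i), corner polygon (Suc (Suc i))}"
    consider "i + 2 < n" | "i + 2 = n" | "i + 1 = n" using i by linarith
    then show False
    proof cases
      case 1
      then show False
        using collinear_cross[OF col] corner_polygon_graph[of i] corner_polygon_graph[of "i + 1"] corner_polygon_graph[of "i + 2"]
          Y_bend[of i] by (simp add: algebra_simps)
    next
      case 2
      then have i': "Suc (Suc i) = n" "0 < i" "i < n - 1" "Suc i = n - 1" using n by auto
      have Y1: "Y (Suc i) = 0" using Y_last i'(4) by simp
      have e1: "Re (corner polygon (Suc i) - corner polygon i) = 1" "Im (corner polygon (Suc i) - corner polygon i) = - Y i"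
        using corner_polygon_graph[of i] corner_polygon_graph[of "Suc i"] i' Y1 by simp_all
      have e2: "Re (corner polygon (Suc (Suc i)) - corner polygon i) = - real i"
        "Im (corner polygon (Suc (Suc i)) - corner polygon i) = - Y i"
        unfolding i'(1) using corner_polygon_graph[of i] corner_polygon_graph_wrap i' by simp_all
      have "1 * (- Y i) = (- Y i) * (- real i)"
        using collinear_cross[OF col] unfolding e1 e2 .
      then have "Y i * (1 + real i) = 0" by (simp add: algebra_simps)
      then show False using Y_pos[OF i'(2,3)] by auto
    next
      case 3
      then have i': "Suc i = n" "0 < i" using n by auto
      have Y1: "Y i = 0" using Y_last i'(1) by auto
      have e1: "Re (corner polygon (Suc i) - corner polygon i) = - real i" "Im (corner polygon (Suc i) - corner polygon i) = 0"
        unfolding i'(1) using corner_polygon_graph[of i] corner_polygon_graph_wrap i' Y1 by simp_all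
      have e2: "Im (corner polygon (Suc (Suc i)) - corner polygon i) = Y 1"
        unfolding i'(1) using corner_polygon_graph[of i] corner_polygon_graph_wrap i' Y1 by simp_all
      have "- real i * Y 1 = 0 * Re (corner polygon (Suc (Suc i)) - corner polygon i)"
        using collinear_cross[OF col] unfolding e1 e2 .
      then have "real i * Y 1 = 0" by simp
      then show False using Y_pos[of 1] i' n by auto
    qed
  qed
qed

lemma perimeter_upper_half_plane: "perimeter polygon \<subseteq> {z. 0 \<le> Im z}"
proof
  fix z assume "z \<in> perimeter polygon"
  then obtain i where i: "i < n" "z \<in> side polygon i" by (auto simp: perimeter_def)
  show "z \<in> {z. 0 \<le> Im z}"
  proof (cases "i = n - 1")
    case True then show ?thesis using lower_side_point i by simp
  next
    case False then show ?thesis using upper_side_nonneg[OF i(2)] i by simp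
  qed
qed

lemma region_upper_half_plane: "z \<in> region polygon \<Longrightarrow> 0 \<le> Im z"
proof (rule ccontr)
  assume z: "z \<in> region polygon" "\<not> 0 \<le> Im z"
  have "- {z. 0 \<le> Im z} \<subseteq> outside (perimeter polygon)"
    using perimeter_upper_half_plane by (intro outside_subset_convex convex_halfspace_Im_ge)
  then have "z \<in> outside (perimeter polygon)" using z by auto
  then show False using z(1) union_with_inside[of "perimeter polygon"] by (auto simp: region_def)
qed

text \<open>
  The vertical ray from \<open>z\<close> upwards avoids the perimeter and is unbounded.
\<close>

lemma exterior_above:
  assumes "j < n" "Re z = real j" "Y j < Im z"
  shows "z \<in> exterior polygon"
proof -
  let ?R = "{w. Re w = real j} \<inter> {w. Y j < Im w}"
  have free: "?R \<inter> perimeter polygon = {}"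
  proof -
    have "w \<notin> perimeter polygon" if w: "Re w = real j" "Y j < Im w" for w
    proof
      assume "w \<in> perimeter polygon"
      then obtain i where i: "i < n" "w \<in> side polygon i" by (auto simp: perimeter_def)
      have "Y j \<ge> 0" using Y_nonneg assms(1) .
      show False
      proof (cases "i = n - 1")
        case True then show ?thesis using lower_side_point i \<open>Y j \<ge> 0\<close> w by simp
      next
        case False
        then have "i + 1 < n" using i by simp
        then obtain r where r: "0 \<le> r" "r \<le> 1" "Re w = real i + r" "Im w = (1 - r) * Y i + r * Y (i + 1)"
          using upper_side_point[OF i(2)] by metis
        have "real j = real i + r" using r(3) w(1) by simp
        then have "real i \<le> real j" "real j \<le> real (i + 1)" using r(1,2) by simp_all
        then have "i \<le> j" "j \<le> i + 1" by (simp_all only: of_nat_le_iff)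
        then consider "j = i" | "j = i + 1" by linarith
        then have "j = i \<and> r = 0 \<or> j = i + 1 \<and> r = 1"
          using \<open>real j = real i + r\<close> by cases auto
        then show ?thesis using r(4) w(2) by auto
      qed
    qed
    then show ?thesis by blast
  qed
  have "{w. Re w = real j} = {w. Re w \<le> real j} \<inter> {w. real j \<le> Re w}" by auto
  then have "convex ?R"
    by (simp only:) (intro convex_Int convex_halfspace_Im_gt convex_halfspace_Re_le convex_halfspace_Re_ge)
  then have conn: "connected ?R" by (rule convex_connected)
  have "\<not> bounded ?R"
  proof
    assume "bounded ?R"
    then obtain B where B: "\<And>w. w \<in> ?R \<Longrightarrow> norm w \<le> B" unfolding bounded_iff by blast
    let ?w = "Complex (real j) (max (Y j + 1) (B + 1))"
    have "norm ?w \<le> B" by (rule B) auto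
    moreover have "B + 1 \<le> norm ?w" using abs_Im_le_cmod[of ?w] by auto
    ultimately show False by simp
  qed
  moreover have "?R \<subseteq> connected_component_set (- perimeter polygon) z"
    using assms free conn by (intro connected_component_maximal) auto
  ultimately have "\<not> bounded (connected_component_set (- perimeter polygon) z)"
    using bounded_subset by blast
  moreover have "z \<notin> perimeter polygon" using free assms by auto
  ultimately show ?thesis by (simp add: exterior_def outside_def)
qed

text \<open>
  A line of sight from \<open>g\<close> to the corner \<open>j\<close> that passes over the corner \<open>X\<close> must not rise above the
  graph there, while \<open>g\<close> itself is not below the real axis. Similar triangles turn this into a bound
  on how far \<open>g\<close> is beyond \<open>X\<close>. The sign of \<open>\<sigma>\<close> selects the direction: positive if \<open>X\<close> is to the
  right of \<open>j\<close>, negative if it is to the left.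
\<close>

lemma visible_slope:
  assumes vis: "visible polygon g (corner polygon j)" and j: "j < n" and X: "X < n"
    and \<sigma>: "0 < \<sigma> * (real X - real j)" "0 \<le> \<sigma> * (Re g - real X)"
  shows "\<sigma> * (Re g - real X) * Y j \<le> \<sigma> * (Re g - real j) * Y X"
proof -
  let ?v = "corner polygon j"
  have v: "?v = Complex (real j) (Y j)" using corner_polygon_graph j .
  define d where "d = \<sigma> * (Re g - real X)"
  define c where "c = \<sigma> * (real X - real j)"
  have dc: "0 \<le> d" "0 < c" "\<sigma> * (Re g - real j) = d + c" "\<sigma> \<noteq> 0"
    using \<sigma> by (auto simp: d_def c_def algebra_simps)
  define r where "r = d / (d + c)"
  have r: "0 \<le> r" "r \<le> 1" using dc by (auto simp: r_def divide_simps)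
  define z where "z = (1 - r) *\<^sub>R g + r *\<^sub>R ?v"
  have "z \<in> closed_segment g ?v" unfolding z_def in_segment using r by blast
  then have "z \<notin> exterior polygon" using vis by (auto simp: visible_def)
  moreover have "Re z = real X"
  proof -
    \<comment> \<open>Up to the factor \<open>\<sigma>\<close>, the horizontal distances of \<open>g\<close> and of the corner \<open>j\<close> from \<open>X\<close> are \<open>d\<close> and
      \<open>c\<close>, so \<open>z\<close> is the point of the line of sight at \<open>X\<close>.\<close>
    have "\<sigma> * ((Re z - real X) * (d + c)) = (\<sigma> * (Re g - real X)) * (d + c) - \<sigma> * (r * (d + c)) * (Re g - real j)"
      by (simp add: z_def v algebra_simps)
    also have "r * (d + c) = d" using dc by (simp add: r_def)
    finally have "\<sigma> * ((Re z - real X) * (d + c)) = d * (d + c) - d * (\<sigma> * (Re g - real j))"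
      by (simp add: d_def algebra_simps)
    then show ?thesis using dc by simp
  qed
  ultimately have "Im z \<le> Y X" using exterior_above[OF X] by (meson not_le)
  moreover have "0 \<le> Im g" using vis region_upper_half_plane by (auto simp: visible_def)
  moreover have "Im z = (1 - r) * Im g + r * Y j" by (simp add: z_def v)
  ultimately have "r * Y j \<le> Y X" using r by (smt (verit) mult_nonneg_nonneg)
  then have "(d + c) * (r * Y j) \<le> (d + c) * Y X" using dc by (intro mult_left_mono) auto
  moreover have "(d + c) * (r * Y j) = d * Y j" using dc by (simp add: r_def)
  ultimately have "d * Y j \<le> (d + c) * Y X" by simp
  then show ?thesis unfolding dc(3) unfolding d_def .
qed

end

text \<open>
  Node \<open>i\<close> belongs to tooth \<open>i div s\<close>. The top corners alternate between two heights, which keeps three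
  consecutive ones from being collinear. The height \<open>2 s\<close> is large against the width \<open>s\<close> of a tooth.
  The bottom corners have height \<open>1\<close>, except for the two ends of the comb on the real axis, so that
  the gaps between teeth are not on the lower side.
\<close>

definition comb_height :: "nat \<Rightarrow> nat \<Rightarrow> nat \<Rightarrow> real" where
  "comb_height s n i =
     (if i = 0 \<or> i = n - 1 then 0
      else if i mod s = 0 \<or> i mod s = s - 1 then 1
      else 2 * real s + real (i mod 2))"

lemma comb_height_simps:
  "i mod s \<noteq> 0 \<Longrightarrow> i mod s \<noteq> s - 1 \<Longrightarrow> i \<noteq> n - 1 \<Longrightarrow> comb_height s n i = 2 * real s + real (i mod 2)"
  "i mod s = 0 \<or> i mod s = s - 1 \<Longrightarrow> comb_height s n i \<le> 1"
  by (auto simp: comb_height_def)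

text \<open>
  The bend at a node depends on its place in the tooth: at a bottom corner some neighbour is a top
  corner, so the graph bends upwards; next to a bottom corner it bends downwards; and between two
  top corners the parity of the middle one differs from that of the others.
\<close>

lemma comb_graph_polygon:
  assumes s: "3 \<le> s" and t: "1 \<le> t"
  shows "graph_polygon (s * t) (comb_height s (s * t))"
proof
  let ?n = "s * t" and ?Y = "comb_height s (s * t)"
  have "s * 1 \<le> s * t" using t by (intro mult_left_mono) auto
  then show n: "3 \<le> s * t" using s by linarith
  show "?Y 0 = 0" "?Y (?n - 1) = 0" by (simp_all add: comb_height_def)
  show "0 < ?Y i" if "0 < i" "i < ?n - 1" for i
    using that s by (auto simp: comb_height_def)
  show "?Y i - 2 * ?Y (i + 1) + ?Y (i + 2) \<noteq> 0" if i: "i + 2 < ?n" for i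
  proof -
    have last: "(?n - 1) mod s = s - 1"
    proof -
      have "?n - 1 = (s - 1) + s * (t - 1)" using s t by (cases t) auto
      then have "(?n - 1) mod s = (s - 1) mod s" by (metis mod_mult_self2)
      then show ?thesis using s by simp
    qed
    have nn: "0 \<le> ?Y j" for j by (simp add: comb_height_def)
    define c where "c = (i + 1) mod s"
    have c: "c < s" using s by (simp add: c_def)
    have next_mod: "(i + 2) mod s = (if c = s - 1 then 0 else c + 1)"
      using mod_Suc[of "i + 1" s] c unfolding c_def by auto
    have prev_mod: "i mod s = (if c = 0 then s - 1 else c - 1)"
      using mod_Suc[of i s] s unfolding c_def by (auto split: if_splits)
    have small: "?Y j \<le> 1" if "j mod s = 0 \<or> j mod s = s - 1" for j
      using that by (rule comb_height_simps)
    have tip: "?Y j = 2 * real s + real (j mod 2)" if "j mod s \<noteq> 0" "j mod s \<noteq> s - 1" for j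
      using that last by (intro comb_height_simps) auto
    consider "c = 0" | "c = s - 1" | "0 < c" "c < s - 1" using c by linarith
    then show ?thesis
    proof cases
      case 1
      have "?Y (i + 2) \<ge> 2 * real s" using tip[of "i + 2"] next_mod 1 s by auto
      moreover have "?Y (i + 1) \<le> 1" using small[of "i + 1"] 1 by (simp add: c_def)
      ultimately show ?thesis using nn[of i] s by auto
    next
      case 2
      have "?Y i \<ge> 2 * real s" using tip[of i] prev_mod 2 s by auto
      moreover have "?Y (i + 1) \<le> 1" using small[of "i + 1"] 2 by (simp add: c_def)
      ultimately show ?thesis using nn[of "i + 2"] s by auto
    next
      case 3
      have mid: "?Y (i + 1) = 2 * real s + real ((i + 1) mod 2)"
        using tip[of "i + 1"] 3 by (simp add: c_def)
      have le: "?Y j \<le> 2 * real s + 1" for j by (auto simp: comb_height_def)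
      have par_nonneg: "0 \<le> real ((i + 1) mod 2)" and s_real: "3 \<le> real s" using s by simp_all
      have par: "real (j mod 2) = 0 \<or> real (j mod 2) = 1" for j by auto
      consider "?Y i \<le> 1" | "?Y (i + 2) \<le> 1" | "?Y i = 2 * real s + real (i mod 2)"
        "?Y (i + 2) = 2 * real s + real ((i + 2) mod 2)"
        using small[of i] small[of "i + 2"] tip[of i] tip[of "i + 2"] by blast
      then show ?thesis
      proof cases
        case 1
        then show ?thesis using mid le[of "i + 2"] par_nonneg s_real by linarith
      next
        case 2
        then show ?thesis using mid le[of i] par_nonneg s_real by linarith
      next
        case 3
        have "real ((i + 1) mod 2) = 1 - real (i mod 2)" by (cases "even i") (auto simp: odd_iff_mod_2_eq_one)
        moreover have "(i + 2) mod 2 = i mod 2" by simp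
        ultimately show ?thesis using 3 mid par[of i] by auto
      qed
    qed
  qed
qed

text \<open>
  The top corners of a tooth form a window of \<open>s - 2 = k + 2\<close> consecutive corners, so some guard
  sees one of them. By the slope lemma this guard has a real part less than \<open>1 / 2\<close> away from the
  tooth, and these ranges are disjoint for different teeth.
\<close>

lemma comb_guard_number:
  fixes k :: int
  assumes k: "-1 \<le> k" and t: "1 \<le> t" and s: "s = nat (k + 4)"
  shows "t \<le> guard_number k (graph_polygon.polygon (s * t) (comb_height s (s * t)))"
proof -
  have s3: "3 \<le> s" using k s by simp
  let ?n = "s * t" and ?Y = "comb_height s (s * t)"
  interpret graph_polygon ?n ?Y by (rule comb_graph_polygon[OF s3 t])
  obtain G where G: "guards k polygon G" "card G = guard_number k polygon"
    using guard_number_attained[OF k] by blast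
  have near: "real (i * s) - 1 / 2 < Re g \<and> Re g < real (i * s + s) - 1 / 2"
    if "i < t" "1 \<le> l" "l < s - 1" and vis: "visible polygon g (corner polygon (i * s + l))" for i l g
  proof -
    let ?j = "i * s + l"
    have "(i + 1) * s \<le> t * s" using that(1) by (intro mult_right_mono) auto
    then have lim: "i * s + s \<le> ?n" by (simp add: algebra_simps)
    then have j: "?j < ?n" "?j \<noteq> ?n - 1" using that by linarith+
    have l: "real l \<le> real s - 2" using that s3 by linarith
    have "?j mod s = l" using that by simp
    then have Yj: "2 * real s \<le> ?Y ?j"
      using comb_height_simps(1)[of ?j s ?n] that j by auto
    have slope: False if X: "X < ?n" "?Y X \<le> 1" and \<sigma>: "1 \<le> \<sigma> * (real X - real ?j)"
      "\<sigma> * (real X - real ?j) \<le> real s - 2" "1 / 2 \<le> \<sigma> * (Re g - real X)" for X \<sigma>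
    proof -
      let ?d = "\<sigma> * (Re g - real X)" and ?c = "\<sigma> * (real X - real ?j)"
      have "?d * ?Y ?j \<le> \<sigma> * (Re g - real ?j) * ?Y X"
        using visible_slope[OF vis j(1) X(1)] \<sigma> by auto
      also have "\<sigma> * (Re g - real ?j) = ?d + ?c" by (simp add: algebra_simps)
      also have "(?d + ?c) * ?Y X \<le> (?d + ?c) * 1" using X \<sigma> by (intro mult_left_mono) auto
      finally have "?d * ?Y ?j \<le> ?d + ?c" by simp
      moreover have "?d * (2 * real s) \<le> ?d * ?Y ?j" using Yj \<sigma> by (intro mult_left_mono) auto
      moreover have "(1/2) * (2 * real s - 1) \<le> ?d * (2 * real s - 1)"
        using \<sigma> s3 by (intro mult_right_mono) auto
      ultimately show False using \<sigma> s3 by (simp add: algebra_simps)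
    qed
    have "real (i * s) - 1 / 2 < Re g"
    proof (rule ccontr)
      assume "\<not> ?thesis"
      then show False
        using slope[of "i * s" "-1"] that l lim comb_height_simps(2)[of "i * s" s ?n] s3 by auto
    qed
    moreover have "Re g < real (i * s + s) - 1 / 2"
    proof (rule ccontr)
      assume *: "\<not> ?thesis"
      have "(s - 1 + i * s) mod s = (s - 1) mod s" by (rule mod_mult_self1)
      then have "(i * s + (s - 1)) mod s = s - 1" using s3 by (simp only: add.commute) simp
      then have "?Y (i * s + (s - 1)) \<le> 1" by (intro comb_height_simps(2)) simp
      moreover have X: "i * s + (s - 1) < ?n" using lim s3 by linarith
      ultimately show False
        using slope[of "i * s + (s - 1)" 1] * that l lim s3 X by (auto simp: of_nat_diff)
    qed
    ultimately show ?thesis by simp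
  qed
  have "\<exists>g\<in>G. real (i * s) - 1 / 2 < Re g \<and> Re g < real (i * s + s) - 1 / 2" if i: "i < t" for i
  proof -
    have "(i + 1) * s \<le> t * s" using i by (intro mult_right_mono) auto
    then have "i * s + 1 < ?n" using s3 by (simp add: algebra_simps)
    then obtain j g where j: "int j < k + 2" "g \<in> G" "visible polygon g (corner polygon (i * s + 1 + j))"
      using G(1) unfolding guards_def by auto
    have "1 + j < s - 1" using j(1) s by linarith
    then show ?thesis
      using near[of i "1 + j" g] i j(2,3) by (auto simp: add.assoc)
  qed
  then obtain f where f: "\<And>i. i < t \<Longrightarrow> f i \<in> G"
    "\<And>i. i < t \<Longrightarrow> real (i * s) - 1 / 2 < Re (f i)" "\<And>i. i < t \<Longrightarrow> Re (f i) < real (i * s + s) - 1 / 2"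
    by metis
  have order: "Re (f i) < Re (f i')" if "i < i'" "i' < t" for i i'
  proof -
    have "(i + 1) * s \<le> i' * s" using that by (intro mult_right_mono) auto
    then have "real (i * s + s) \<le> real (i' * s)" by (simp only: of_nat_le_iff) simp
    then show ?thesis using f(3)[of i] f(2)[of i'] that by linarith
  qed
  have "inj_on f {..<t}"
  proof (rule inj_onI)
    fix i i' assume "i \<in> {..<t}" "i' \<in> {..<t}" "f i = f i'"
    then show "i = i'" using order[of i i'] order[of i' i] by (cases i i' rule: linorder_cases) auto
  qed
  moreover have "f ` {..<t} \<subseteq> G" using f(1) by auto
  moreover have "finite G" using G(1) by (simp add: guards_def)
  ultimately have "card {..<t} \<le> card G" by (rule card_inj_on_le)
  then show ?thesis using G(2) by simp
qed

section \<open>The bound and its sharpness\<close>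

theorem theorem11:
  fixes k :: int
  assumes "k \<ge> -1"
  shows "(\<forall>(P :: complex list) (n :: nat).
            simple_polygon P \<and> card (corners P) = n \<and> int n \<ge> k + 4 \<longrightarrow>
            real (guard_number k P) \<le> real n / real_of_int (k + 4)) \<and>
         (\<forall>t :: nat. t \<ge> 1 \<longrightarrow>
            (\<exists>P :: complex list. simple_polygon P \<and> guard_number k P = t \<and>
               real t = real (card (corners P)) / real_of_int (k + 4)))"
proof -
  define s where "s = nat (k + 4)"
  have s: "3 \<le> s" "real_of_int (k + 4) = real s" using assms by (simp_all add: s_def)
  have card: "card (corners P) = length P" if "simple_polygon P" for P
    using that by (simp add: simple_polygon_def corners_def distinct_card)
  have upper: "real (guard_number k P) \<le> real n / real_of_int (k + 4)"
    if P: "simple_polygon P" "card (corners P) = n" "int n \<ge> k + 4" for P n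
  proof -
    have n: "length P = n" using P card by simp
    then have "guard_number k P \<le> n div s"
      using guard_number_upper_bound[OF assms P(1)] P(3) by (simp add: s_def)
    then have "real (guard_number k P) \<le> real (n div s)" by simp
    also have "\<dots> \<le> real n / real s" by (rule of_nat_div_le_of_nat)
    finally show ?thesis using s(2) by simp
  qed
  have lower: "\<exists>P. simple_polygon P \<and> guard_number k P = t \<and>
      real t = real (card (corners P)) / real_of_int (k + 4)" if t: "1 \<le> t" for t
  proof -
    interpret graph_polygon "s * t" "comb_height s (s * t)" by (rule comb_graph_polygon[OF s(1) t])
    have len: "length polygon = s * t" by simp
    have "s * 1 \<le> s * t" using t by (intro mult_left_mono) auto
    then have "s \<le> length polygon" unfolding len by simp
    then have "guard_number k polygon \<le> s * t div s"
      using guard_number_upper_bound[OF assms simple_polygon_graph, folded s_def] unfolding len by blast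
    moreover have "t \<le> guard_number k polygon"
      using comb_guard_number[OF assms t s_def] .
    moreover have "s * t div s = t" using s(1) by simp
    ultimately have "guard_number k polygon = t" by linarith
    moreover have "real t = real (card (corners polygon)) / real_of_int (k + 4)"
      using s card[OF simple_polygon_graph] by simp
    ultimately show ?thesis using simple_polygon_graph by blast
  qed
  show ?thesis using upper lower by blast
qed

end
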